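(* Let $\alpha$ be $S^+$-admissible, $(a,b)$ be an $\alpha$-compatible pair, $r\in\mathbb{N}^*$, and $N=N(\alpha,a,b)$. The quotient $\mathscr{C}_{a,b,r}/\mathcal{G}_{(a,b)}$, which parameterises the connected components of the fibre $\Phi_{\alpha,r}^{-1}([(a,b)])=\Psi_{\alpha,r}^{-1}([N(\alpha,a,b)])$ (the orbit of $[c]_{ab}$ corresponding to the connected component consisting of the classes of the elements $(a,b,[c]_{ab},[t]_{ab})$, $t\in\mathbb{C}$), can be naturally identified, via the map $c\mapsto p(a,b,c,r)$, with the quotient of $$\mathbb{Z}_{N,r}:=\mathbb{Z}^2/\big((I_2-N)\mathbb{Z}^2+r\mathbb{Z}^2\big)$$ by the group $Z^+_{\mathrm{GL}(2,\mathbb{Z})}(N)$ acting on $\mathbb{Z}_{N,r}$ by $K*[p]:=[\varepsilon_KKp]$, where $\varepsilon_K=\det(K)$.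
   Context: $\mathbb{N}^*=\{1,2,\dots\}$. For $x,y\in\mathbb{R}^2$, $x\wedge y=x_1y_2-x_2y_1$. Elements of $\mathbb{R}^2$ are columns; $k=(k_1,k_2)\in\mathbb{Z}^2$ in the action (ii) below is treated as a row, so $ka=k_1a_1+k_2a_2$. $\alpha$ is $S^+$-admissible if $\alpha=\frac{\theta+\sqrt{\theta^2-4}}{2}$ with $\theta\in\mathbb{Z}$, $\theta\ge3$. Put $d=\theta-2$, $\mathbb{Z}_d=\mathbb{Z}/d\mathbb{Z}$. $\mathcal{P}_\alpha$ is the set of linearly independent pairs $(a,b)\in\mathbb{R}^2\times\mathbb{R}^2$ that are $\alpha$-compatible, i.e. such that $N=(n_{ij})=N(\alpha,a,b):=Q\,\mathrm{diag}(\alpha,\alpha^{-1})Q^{-1}\in M_2(\mathbb{Z})$, $Q$ being the matrix with columns $a,b$. $\mathcal{N}_\alpha=\{N\in\mathrm{SL}(2,\mathbb{Z})\mid\alpha\in\mathrm{Spec}(N)\}$, and $\sim$ is conjugation by $\mathrm{GL}(2,\mathbb{Z})$. For $(a,b)\in\mathcal{P}_\alpha$, $r\in\mathbb{N}^*$, $\mathcal{C}_{a,b,r}$ is the set of $c\in\mathbb{R}^2$ for which there is $p=p(a,b,c,r)\in\mathbb{Z}^2$ with $$(I_2-N)\Big(c-\tfrac12\begin{pmatrix}a_1b_1\\ a_2b_2\end{pmatrix}\Big)-\tfrac{b\wedge a}{2}\begin{pmatrix}n_{11}n_{12}\\ n_{21}n_{22}\end{pmatrix}=\tfrac{b\wedge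 a}{r}\,p(a,b,c,r).$$ $\mathcal{T}_{\alpha,r}$ is the set of triples $(a,b,c)$ with $(a,b)\in\mathcal{P}_\alpha$, $c\in\mathcal{C}_{a,b,r}$, with the coarsest topology making $(a,b,c)\mapsto N(\alpha,a,b)\in\mathrm{SL}(2,\mathbb{Z})$, $(a,b,c)\mapsto p(a,b,c,r)\in\mathbb{Z}^2$ (discrete targets) and $(a,b,c)\mapsto(a,b)$ continuous; $\mathcal{A}_{\alpha,r}=\mathcal{T}_{\alpha,r}\times\mathbb{C}$ has the product topology. Put $[c]_{ab}=c+\frac{b\wedge a}{r}\mathbb{Z}^2$, $[t]_{ab}=t+\frac{b\wedge a}{r}\mathbb{Z}$, $\mathscr{C}_{a,b,r}=\mathcal{C}_{a,b,r}/\frac{b\wedge a}{r}\mathbb{Z}^2$, and let $\mathscr{A}_{\alpha,r}$ be the set of all $(a,b,[c]_{ab},[t]_{ab})$ with $(a,b,c,t)\in\mathcal{A}_{\alpha,r}$, with the quotient topology. Actions on $\mathscr{A}_{\alpha,r}$ (all well defined): (i) $K=(k_{ij})\in\mathrm{GL}(2,\mathbb{Z})$: $K\cdot(a,b,[c]_{ab},[t]_{ab})=(A,B,[C]_{AB},[t]_{AB})$, $A=Ka$, $B=Kb$, $C=\tfrac12\begin{pmatrix}A_1B_1\\ A_2B_2\end{pmatrix}+K\big(c-\tfrac12\begin{pmatrix}a_1b_1\\ a_2b_2\end{pmatrix}\big)+\tfrac{b\wedge a}{2}\begin{pmatrix}k_{11}k_{12}\\ k_{21}k_{22}\end{pmatrix}$.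 (ii) $k\in\mathbb{Z}^2$: $k\cdot(a,b,[c]_{ab},[t]_{ab})=(a,b,[k\cdot c]_{ab},[k\cdot_ct]_{ab})$, $k\cdot c=c-\tfrac{\alpha(ka)}{\alpha-1}b-\tfrac{kb}{\alpha-1}a$, $k\cdot_ct=t+\tfrac{\alpha(ka)(kb)}{1-\alpha}+kc+\tfrac{k_1(k_1-1)a_1b_1+k_2(k_2-1)a_2b_2}{2}+k_1k_2b_1a_2$; this descends to an action of $\mathbb{Z}_d^2=\mathbb{Z}^2/d\mathbb{Z}^2$. (iii) $(\mu,\rho)\in\mathbb{R}^*_+\times\mathbb{R}^*$: $(a,b,[c]_{ab},[t]_{ab})\mapsto(\mu a,\rho b,[\mu\rho c]_{\mu a,\rho b},[\mu\rho t]_{\mu a,\rho b})$. Let $\mathcal{G}=(\mathbb{R}^*_+\times\mathbb{R}^* )\times(\mathrm{GL}(2,\mathbb{Z})\ltimes_\psi\mathbb{Z}_d^2)$, where the semidirect product has the law $(K,[k])*(K',[k'])=(KK',[kK'+k'])$. $\mathcal{G}$ acts on $\mathscr{A}_{\alpha,r}$ by $((\mu,\rho),(K,[k]))\cdot x=K\cdot(k\cdot((\mu,\rho)\cdot x))$, on $\mathcal{P}_\alpha$ by $(a,b)\mapsto(\mu Ka,\rho Kb)$, and on $\mathcal{N}_\alpha$ by $N\mapsto KNK^{-1}$. $\mathscr{Q}_{\alpha,r}=\mathscr{A}_{\alpha,r}/\mathcal{G}$ has the quotient topology. $\Phi_{\alpha,r}:\mathscr{Q}_{\alpha,r}\to\mathcal{P}_\alpha/\mathcal{G}$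 and $\Psi_{\alpha,r}:\mathscr{Q}_{\alpha,r}\to\mathcal{N}_\alpha/\!\sim$ are induced by $(a,b,[c]_{ab},[t]_{ab})\mapsto(a,b)$ and $(a,b,[c]_{ab},[t]_{ab})\mapsto N(\alpha,a,b)$. $\mathcal{G}_{(a,b)}$ is the stabiliser of $(a,b)\in\mathcal{P}_\alpha$; it acts on $\mathscr{C}_{a,b,r}$ through its action on the third component of elements $(a,b,[c]_{ab},[t]_{ab})$. The positive centraliser is $Z^+_{\mathrm{GL}(2,\mathbb{Z})}(N)=\{K\in\mathrm{GL}(2,\mathbb{Z})\mid KN=NK,\ Ka\in\mathbb{R}^*_+a\}$. *)

theory Defs
  imports "HOL-Analysis.Analysis" "HOL-Algebra.Group_Action"
begin

section \<open>Quotients, induced maps and the quotient topology\<close>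

text \<open>The map induced on the quotient \<open>q ` S\<close> by a map \<open>f\<close> on \<open>S\<close> that is constant on
  the fibres of \<open>q\<close>.\<close>

definition induced_map :: "('a \<Rightarrow> 'b) \<Rightarrow> 'a set \<Rightarrow> ('a \<Rightarrow> 'c) \<Rightarrow> 'b \<Rightarrow> 'c" where
  "induced_map q S f x = the_elem (f ` {y \<in> S. q y = x})"

definition quotient_topology :: "'a topology \<Rightarrow> ('a \<Rightarrow> 'b) \<Rightarrow> 'b topology" where
  "quotient_topology X q =
     topology (\<lambda>U. U \<subseteq> q ` topspace X \<and> openin X {x \<in> topspace X. q x \<in> U})"

lemma openin_quotient_topology:
  "openin (quotient_topology X q) U \<longleftrightarrow>
     U \<subseteq> q ` topspace X \<and> openin X {x \<in> topspace X. q x \<in> U}"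
proof -
  let ?P = "\<lambda>U. U \<subseteq> q ` topspace X \<and> openin X {x \<in> topspace X. q x \<in> U}"
  have "?P (S \<inter> T)" if "?P S" "?P T" for S T
  proof -
    have "{x \<in> topspace X. q x \<in> S \<inter> T} =
        {x \<in> topspace X. q x \<in> S} \<inter> {x \<in> topspace X. q x \<in> T}"
      by auto
    with that show ?thesis by auto
  qed
  moreover have "?P (\<Union>\<K>)" if "\<forall>K\<in>\<K>. ?P K" for \<K>
  proof -
    have "{x \<in> topspace X. q x \<in> \<Union>\<K>} = (\<Union>K\<in>\<K>. {x \<in> topspace X. q x \<in> K})"
      by auto
    with that show ?thesis by auto
  qed
  ultimately have "istopology ?P"
    unfolding istopology_def by blast
  then show ?thesis
    by (simp add: quotient_topology_def topology_inverse')
qed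

lemma topspace_quotient_topology: "topspace (quotient_topology X q) = q ` topspace X"
proof
  show "topspace (quotient_topology X q) \<subseteq> q ` topspace X"
    using openin_quotient_topology openin_topspace by metis
  have "{x \<in> topspace X. q x \<in> q ` topspace X} = topspace X"
    by auto
  then have "openin (quotient_topology X q) (q ` topspace X)"
    by (simp add: openin_quotient_topology)
  then show "q ` topspace X \<subseteq> topspace (quotient_topology X q)"
    by (rule openin_subset)
qed


section \<open>Compatible pairs\<close>

definition S_plus_admissible :: "real \<Rightarrow> bool" where
  "S_plus_admissible \<alpha> \<longleftrightarrow>
     (\<exists>\<theta>::int. \<theta> \<ge> 3 \<and> \<alpha> = (of_int \<theta> + sqrt ((of_int \<theta>)\<^sup>2 - 4)) / 2)"

definition theta :: "real \<Rightarrow> int" where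
  "theta \<alpha> = (THE \<theta>::int. \<theta> \<ge> 3 \<and> \<alpha> = (of_int \<theta> + sqrt ((of_int \<theta>)\<^sup>2 - 4)) / 2)"

definition dpar :: "real \<Rightarrow> int" where
  "dpar \<alpha> = theta \<alpha> - 2"

definition wedge :: "real^2 \<Rightarrow> real^2 \<Rightarrow> real" where
  "wedge x y = x$1 * y$2 - x$2 * y$1"

abbreviation real_mat :: "int^2^2 \<Rightarrow> real^2^2" where
  "real_mat \<equiv> map_matrix real_of_int"

definition real_vec :: "int^2 \<Rightarrow> real^2" where
  "real_vec m = (\<chi> i. real_of_int (m$i))"

text \<open>The vector of half products \<open>(a\<^sub>1 b\<^sub>1 / 2, a\<^sub>2 b\<^sub>2 / 2)\<close>, and the vector of products of the
  two entries of each row of a matrix.\<close>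

definition half_prod :: "real^2 \<Rightarrow> real^2 \<Rightarrow> real^2" where
  "half_prod a b = (\<chi> i. a$i * b$i / 2)"

definition row_prods :: "int^2^2 \<Rightarrow> real^2" where
  "row_prods M = (\<chi> i. real_of_int (M$i$1 * M$i$2))"

definition Q_mat :: "real^2 \<Rightarrow> real^2 \<Rightarrow> real^2^2" where
  "Q_mat a b = transpose (vector [a, b])"

definition diag_mat :: "real \<Rightarrow> real^2^2" where
  "diag_mat \<alpha> = vector [vector [\<alpha>, 0], vector [0, inverse \<alpha>]]"

definition real_N :: "real \<Rightarrow> real^2 \<Rightarrow> real^2 \<Rightarrow> real^2^2" where
  "real_N \<alpha> a b = Q_mat a b ** diag_mat \<alpha> ** matrix_inv (Q_mat a b)"

text \<open>\<^const>\<open>independent\<close> is a property of sets, so independence of the pair also requires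
  \<open>a \<noteq> b\<close>.\<close>

definition compatible_pairs :: "real \<Rightarrow> ((real^2) \<times> (real^2)) set" where
  "compatible_pairs \<alpha> =
     {(a, b). a \<noteq> b \<and> independent {a, b} \<and> (\<forall>i j. real_N \<alpha> a b $ i $ j \<in> \<int>)}"

definition N_mat :: "real \<Rightarrow> real^2 \<Rightarrow> real^2 \<Rightarrow> int^2^2" where
  "N_mat \<alpha> a b = (THE N. real_mat N = real_N \<alpha> a b)"

definition GL2Z :: "(int^2^2) set" where
  "GL2Z = {K. invertible K}"

definition SL2Z :: "(int^2^2) set" where
  "SL2Z = {N. det N = 1}"

definition N_alpha :: "real \<Rightarrow> (int^2^2) set" where
  "N_alpha \<alpha> = {N \<in> SL2Z. \<exists>v. v \<noteq> 0 \<and> real_mat N *v v = \<alpha> *s v}"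

definition conj_class :: "real \<Rightarrow> int^2^2 \<Rightarrow> (int^2^2) set" where
  "conj_class \<alpha> N = {M \<in> N_alpha \<alpha>. \<exists>K \<in> GL2Z. M = K ** N ** matrix_inv K}"


section \<open>The spaces of triples and quadruples\<close>

definition p_eq :: "real \<Rightarrow> nat \<Rightarrow> real^2 \<Rightarrow> real^2 \<Rightarrow> real^2 \<Rightarrow> int^2 \<Rightarrow> bool" where
  "p_eq \<alpha> r a b c p \<longleftrightarrow>
     (mat 1 - real_mat (N_mat \<alpha> a b)) *v (c - half_prod a b)
       - (wedge b a / 2) *\<^sub>R row_prods (N_mat \<alpha> a b)
     = (wedge b a / real r) *\<^sub>R real_vec p"

definition C_set :: "real \<Rightarrow> nat \<Rightarrow> real^2 \<Rightarrow> real^2 \<Rightarrow> (real^2) set" where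
  "C_set \<alpha> r a b = {c. \<exists>p. p_eq \<alpha> r a b c p}"

definition p_of :: "real \<Rightarrow> nat \<Rightarrow> real^2 \<Rightarrow> real^2 \<Rightarrow> real^2 \<Rightarrow> int^2" where
  "p_of \<alpha> r a b c = (THE p. p_eq \<alpha> r a b c p)"

type_synonym triple = "(real^2) \<times> (real^2) \<times> (real^2)"

definition T_set :: "real \<Rightarrow> nat \<Rightarrow> triple set" where
  "T_set \<alpha> r = {(a, b, c). (a, b) \<in> compatible_pairs \<alpha> \<and> c \<in> C_set \<alpha> r a b}"

text \<open>The coarsest topology making the three maps continuous is generated by the preimages of
  open sets; in the discrete targets every set is open.\<close>

definition T_top :: "real \<Rightarrow> nat \<Rightarrow> triple topology" where
  "T_top \<alpha> r = topology_generated_by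
     ({{(a, b, c) \<in> T_set \<alpha> r. N_mat \<alpha> a b \<in> U} | U. U \<subseteq> SL2Z} \<union>
      {{(a, b, c) \<in> T_set \<alpha> r. p_of \<alpha> r a b c \<in> U} | U. True} \<union>
      {{(a, b, c) \<in> T_set \<alpha> r. (a, b) \<in> U} | U. open U})"

type_synonym quadruple = "triple \<times> complex"

definition A_set :: "real \<Rightarrow> nat \<Rightarrow> quadruple set" where
  "A_set \<alpha> r = T_set \<alpha> r \<times> UNIV"

definition A_top :: "real \<Rightarrow> nat \<Rightarrow> quadruple topology" where
  "A_top \<alpha> r = prod_topology (T_top \<alpha> r) euclidean"

definition c_class :: "nat \<Rightarrow> real^2 \<Rightarrow> real^2 \<Rightarrow> real^2 \<Rightarrow> (real^2) set" where
  "c_class r a b c = {c + (wedge b a / real r) *\<^sub>R real_vec m | m. True}"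

definition t_class :: "nat \<Rightarrow> real^2 \<Rightarrow> real^2 \<Rightarrow> complex \<Rightarrow> complex set" where
  "t_class r a b t = {t + of_real (wedge b a / real r * real_of_int m) | m. True}"

definition C_quot :: "real \<Rightarrow> nat \<Rightarrow> real^2 \<Rightarrow> real^2 \<Rightarrow> (real^2) set set" where
  "C_quot \<alpha> r a b = c_class r a b ` C_set \<alpha> r a b"

type_synonym quad_class = "(real^2) \<times> (real^2) \<times> (real^2) set \<times> complex set"

definition quad_class :: "nat \<Rightarrow> quadruple \<Rightarrow> quad_class" where
  "quad_class r = (\<lambda>((a, b, c), t). (a, b, c_class r a b c, t_class r a b t))"

definition AA_set :: "real \<Rightarrow> nat \<Rightarrow> quad_class set" where
  "AA_set \<alpha> r = quad_class r ` A_set \<alpha> r"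

definition AA_top :: "real \<Rightarrow> nat \<Rightarrow> quad_class topology" where
  "AA_top \<alpha> r = quotient_topology (A_top \<alpha> r) (quad_class r)"


section \<open>The actions\<close>

text \<open>Each of the three actions is given by its formula on representatives and then induced on
  classes.\<close>

definition K_rep :: "int^2^2 \<Rightarrow> quadruple \<Rightarrow> quadruple" where
  "K_rep K = (\<lambda>((a, b, c), t).
     let A = real_mat K *v a; B = real_mat K *v b in
     ((A, B, half_prod A B + real_mat K *v (c - half_prod a b)
               + (wedge b a / 2) *\<^sub>R row_prods K), t))"

definition row_times :: "int^2 \<Rightarrow> real^2 \<Rightarrow> real" where
  "row_times k a = real_of_int (k$1) * a$1 + real_of_int (k$2) * a$2"

definition k_dot_c :: "real \<Rightarrow> int^2 \<Rightarrow> real^2 \<Rightarrow> real^2 \<Rightarrow> real^2 \<Rightarrow> real^2" where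
  "k_dot_c \<alpha> k a b c =
     c - (\<alpha> * row_times k a / (\<alpha> - 1)) *\<^sub>R b - (row_times k b / (\<alpha> - 1)) *\<^sub>R a"

definition k_dot_t ::
    "real \<Rightarrow> int^2 \<Rightarrow> real^2 \<Rightarrow> real^2 \<Rightarrow> real^2 \<Rightarrow> complex \<Rightarrow> complex" where
  "k_dot_t \<alpha> k a b c t =
     (let k1 = real_of_int (k$1); k2 = real_of_int (k$2) in
      t + of_real (\<alpha> * row_times k a * row_times k b / (1 - \<alpha>) + row_times k c
            + (k1 * (k1 - 1) * a$1 * b$1 + k2 * (k2 - 1) * a$2 * b$2) / 2
            + k1 * k2 * b$1 * a$2))"

definition k_rep :: "real \<Rightarrow> int^2 \<Rightarrow> quadruple \<Rightarrow> quadruple" where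
  "k_rep \<alpha> k = (\<lambda>((a, b, c), t). ((a, b, k_dot_c \<alpha> k a b c), k_dot_t \<alpha> k a b c t))"

definition scale_rep :: "real \<times> real \<Rightarrow> quadruple \<Rightarrow> quadruple" where
  "scale_rep = (\<lambda>(\<mu>, \<rho>) ((a, b, c), t).
     ((\<mu> *\<^sub>R a, \<rho> *\<^sub>R b, (\<mu> * \<rho>) *\<^sub>R c), (\<mu> * \<rho>) *\<^sub>R t))"

definition on_classes ::
    "real \<Rightarrow> nat \<Rightarrow> (quadruple \<Rightarrow> quadruple) \<Rightarrow> quad_class \<Rightarrow> quad_class" where
  "on_classes \<alpha> r f = induced_map (quad_class r) (A_set \<alpha> r) (quad_class r \<circ> f)"

definition Zd_class :: "real \<Rightarrow> int^2 \<Rightarrow> (int^2) set" where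
  "Zd_class \<alpha> k = {k + dpar \<alpha> *s m | m. True}"

definition Zd_act :: "real \<Rightarrow> nat \<Rightarrow> (int^2) set \<Rightarrow> quad_class \<Rightarrow> quad_class" where
  "Zd_act \<alpha> r \<kappa> x =
     induced_map (Zd_class \<alpha>) UNIV (\<lambda>k. on_classes \<alpha> r (k_rep \<alpha> k) x) \<kappa>"

definition pos_reals :: "real monoid" where
  "pos_reals = \<lparr>carrier = {\<mu>. \<mu> > 0}, mult = (*), one = 1\<rparr>"

definition nonzero_reals :: "real monoid" where
  "nonzero_reals = \<lparr>carrier = {\<rho>. \<rho> \<noteq> 0}, mult = (*), one = 1\<rparr>"

text \<open>The second component of the product is the coset \<open>[kK' + k']\<close>, computed elementwise.\<close>

definition semidirect :: "real \<Rightarrow> ((int^2^2) \<times> (int^2) set) monoid" where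
  "semidirect \<alpha> =
     \<lparr>carrier = GL2Z \<times> range (Zd_class \<alpha>),
      mult = (\<lambda>(K, \<kappa>) (K', \<kappa>'). (K ** K', {k v* K' + k' | k k'. k \<in> \<kappa> \<and> k' \<in> \<kappa>'})),
      one = (mat 1, Zd_class \<alpha> 0)\<rparr>"

type_synonym G_elem = "(real \<times> real) \<times> ((int^2^2) \<times> (int^2) set)"

definition G_grp :: "real \<Rightarrow> G_elem monoid" where
  "G_grp \<alpha> = (pos_reals \<times>\<times> nonzero_reals) \<times>\<times> semidirect \<alpha>"

definition G_act :: "real \<Rightarrow> nat \<Rightarrow> G_elem \<Rightarrow> quad_class \<Rightarrow> quad_class" where
  "G_act \<alpha> r = (\<lambda>(s, (K, \<kappa>)) x.
     on_classes \<alpha> r (K_rep K) (Zd_act \<alpha> r \<kappa> (on_classes \<alpha> r (scale_rep s) x)))"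

definition P_act :: "G_elem \<Rightarrow> (real^2) \<times> (real^2) \<Rightarrow> (real^2) \<times> (real^2)" where
  "P_act = (\<lambda>((\<mu>, \<rho>), (K, \<kappa>)) (a, b). (\<mu> *\<^sub>R (real_mat K *v a), \<rho> *\<^sub>R (real_mat K *v b)))"

definition stab_grp :: "real \<Rightarrow> real^2 \<Rightarrow> real^2 \<Rightarrow> G_elem monoid" where
  "stab_grp \<alpha> a b = (G_grp \<alpha>)\<lparr>carrier := stabilizer (G_grp \<alpha>) P_act (a, b)\<rparr>"

definition third :: "quad_class \<Rightarrow> (real^2) set" where
  "third = (\<lambda>(a, b, C, T). C)"

definition C_act ::
    "real \<Rightarrow> nat \<Rightarrow> real^2 \<Rightarrow> real^2 \<Rightarrow> G_elem \<Rightarrow> (real^2) set \<Rightarrow> (real^2) set" where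
  "C_act \<alpha> r a b g =
     induced_map third {(a', b', C, T) \<in> AA_set \<alpha> r. a' = a \<and> b' = b} (third \<circ> G_act \<alpha> r g)"


section \<open>The quotient space and its two projections\<close>

abbreviation AA_orbit :: "real \<Rightarrow> nat \<Rightarrow> quad_class \<Rightarrow> quad_class set" where
  "AA_orbit \<alpha> r \<equiv> orbit (G_grp \<alpha>) (G_act \<alpha> r)"

abbreviation P_orbit :: "real \<Rightarrow> (real^2) \<times> (real^2) \<Rightarrow> ((real^2) \<times> (real^2)) set" where
  "P_orbit \<alpha> \<equiv> orbit (G_grp \<alpha>) P_act"

definition QQ_set :: "real \<Rightarrow> nat \<Rightarrow> quad_class set set" where
  "QQ_set \<alpha> r = orbits (G_grp \<alpha>) (AA_set \<alpha> r) (G_act \<alpha> r)"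

definition QQ_top :: "real \<Rightarrow> nat \<Rightarrow> quad_class set topology" where
  "QQ_top \<alpha> r = quotient_topology (AA_top \<alpha> r) (AA_orbit \<alpha> r)"

definition Phi :: "real \<Rightarrow> nat \<Rightarrow> quad_class set \<Rightarrow> ((real^2) \<times> (real^2)) set" where
  "Phi \<alpha> r = induced_map (AA_orbit \<alpha> r) (AA_set \<alpha> r) (\<lambda>(a, b, C, T). P_orbit \<alpha> (a, b))"

definition Psi :: "real \<Rightarrow> nat \<Rightarrow> quad_class set \<Rightarrow> (int^2^2) set" where
  "Psi \<alpha> r =
     induced_map (AA_orbit \<alpha> r) (AA_set \<alpha> r) (\<lambda>(a, b, C, T). conj_class \<alpha> (N_mat \<alpha> a b))"

definition Phi_fibre :: "real \<Rightarrow> nat \<Rightarrow> real^2 \<Rightarrow> real^2 \<Rightarrow> quad_class set set" where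
  "Phi_fibre \<alpha> r a b = {X \<in> QQ_set \<alpha> r. Phi \<alpha> r X = P_orbit \<alpha> (a, b)}"

definition Psi_fibre :: "real \<Rightarrow> nat \<Rightarrow> int^2^2 \<Rightarrow> quad_class set set" where
  "Psi_fibre \<alpha> r N = {X \<in> QQ_set \<alpha> r. Psi \<alpha> r X = conj_class \<alpha> N}"


section \<open>The positive centraliser\<close>

definition pos_centraliser :: "int^2^2 \<Rightarrow> real^2 \<Rightarrow> (int^2^2) monoid" where
  "pos_centraliser N a =
     \<lparr>carrier = {K \<in> GL2Z. K ** N = N ** K \<and> (\<exists>s>0. real_mat K *v a = s *\<^sub>R a)},
      mult = (**), one = mat 1\<rparr>"

definition ZN_class :: "int^2^2 \<Rightarrow> nat \<Rightarrow> int^2 \<Rightarrow> (int^2) set" where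
  "ZN_class N r p = {p + ((mat 1 - N) *v m + int r *s n) | m n. True}"

definition ZN :: "int^2^2 \<Rightarrow> nat \<Rightarrow> (int^2) set set" where
  "ZN N r = range (ZN_class N r)"

text \<open>Restricted to \<^term>\<open>ZN N r\<close> because \<^locale>\<open>group_action\<close> asks for extensional
  functions.\<close>

definition ZN_act :: "int^2^2 \<Rightarrow> nat \<Rightarrow> int^2^2 \<Rightarrow> (int^2) set \<Rightarrow> (int^2) set" where
  "ZN_act N r K =
     restrict (induced_map (ZN_class N r) UNIV (\<lambda>p. ZN_class N r (det K *s (K *v p)))) (ZN N r)"

end

theory Submission
  imports Defs
begin

text \<open>Since \<open>I - N\<close> is invertible over the reals, \<open>c\<close> is determined by \<open>p\<close>, and translating \<open>c\<close> by
  the lattice changes \<open>p\<close> by \<open>(I - N) \<int>\<^sup>2\<close>. A scaling leaves \<open>p\<close> unchanged, a translation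
  \<open>k\<close> adds \<open>r (- k\<^sub>2, k\<^sub>1)\<close> to it, and \<open>K\<close> sends it to \<open>det K \<cdot> K p\<close> modulo \<open>r \<int>\<^sup>2\<close>, because
  the vector of row products is a cocycle modulo 2. An element stabilises \<open>(a, b)\<close> exactly when its
  matrix part commutes with \<open>N\<close>, has \<open>a\<close> as an eigenvector for a positive eigenvalue, and its scaling
  part is the inverse of the eigenvalues; this identifies the orbits of \<open>c\<close> with those of \<open>p\<close>.
  The classes with a given orbit of \<open>c\<close> form a continuous image of \<open>\<complex>\<close>, and they form an open set because
  \<open>N\<close> and \<open>p\<close> are locally constant and determine a triple up to scaling.\<close>

section \<open>Compatible pairs\<close>

text \<open>Write w for \<open>wedge b a\<close>. The formulas carry half-integral corrections,
  products of two coordinates over 2, while classes are taken modulo multiples of w/r. The recurring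
  obstacle is therefore to show that the halves combine to whole multiples of w; this rests on x*x =
  x modulo 2 and on odd determinants. Some composition laws hold on representatives only up to
  multiples of w, so an action exists only on classes. The number d enters as -det(I - N) = trace N
  - 2: the adjugate of I - N puts d Z^2 inside (I - N) Z^2, which is the first reason why
  translations by d Z^2 act trivially on classes. The sign det K comes from w: passing from (a, b)
  to (Ka, Kb) multiplies w by det K, and \<open>p\<close> is measured in units of w/r. The condition
  \<mu> > 0 is harmless when fibres are compared, because -K conjugates N as K does. In the
  stabiliser it is a real restriction, and there it becomes the positivity in the
  centraliser.\<close>

lemmas vec2_simps = vec_eq_iff forall_2 matrix_vector_mult_def vector_matrix_mult_def
  matrix_matrix_mult_def sum_2 mat_def real_vec_def half_prod_def row_prods_def

text \<open>\<open>\<alpha>\<close> is the larger root of x^2 - \<theta> x + 1, so \<theta> is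
  recovered as \<open>\<alpha> + inverse \<alpha>\<close>; this makes the description defining
  \<open>theta\<close> unique.\<close>

lemma S_plus_admissibleD:
  assumes "S_plus_admissible \<alpha>"
  shows "\<alpha> > 1" "\<alpha> + inverse \<alpha> = of_int (theta \<alpha>)" "theta \<alpha> \<ge> 3"
proof -
  obtain \<theta> :: int where \<theta>: "\<theta> \<ge> 3" "\<alpha> = (of_int \<theta> + sqrt ((of_int \<theta>)\<^sup>2 - 4)) / 2"
    using assms by (auto simp: S_plus_admissible_def)
  have key: "\<alpha> > 1 \<and> \<alpha> + inverse \<alpha> = of_int \<theta>"
    if "\<theta> \<ge> 3" "\<alpha> = (of_int \<theta> + sqrt ((of_int \<theta>)\<^sup>2 - 4)) / 2" for \<theta> :: int
  proof -
    define s where "s = sqrt ((of_int \<theta>)\<^sup>2 - 4)"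
    have th: "(of_int \<theta> :: real) \<ge> 3" using that by linarith
    have "(of_int \<theta> :: real)\<^sup>2 \<ge> 3\<^sup>2" using th by (intro power_mono) auto
    then have s: "s \<ge> 0" "s\<^sup>2 = (of_int \<theta>)\<^sup>2 - 4"
      by (auto simp: s_def)
    have \<alpha>: "\<alpha> = (of_int \<theta> + s) / 2" using that by (simp add: s_def)
    have "\<alpha> > 1" using th s(1) unfolding \<alpha> by simp
    moreover have "\<alpha> * \<alpha> + 1 = of_int \<theta> * \<alpha>"
      using s(2) unfolding \<alpha> by (simp add: field_simps power2_eq_square)
    ultimately show ?thesis by (simp add: field_simps)
  qed
  have "theta \<alpha> = \<theta>"
    unfolding theta_def
  proof (rule the_equality)
    fix \<theta>' :: int
    assume "3 \<le> \<theta>' \<and> \<alpha> = (of_int \<theta>' + sqrt ((of_int \<theta>')\<^sup>2 - 4)) / 2"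
    then show "\<theta>' = \<theta>" using key[of \<theta>'] key[OF \<theta>] by simp
  qed (use \<theta> in auto)
  then show "\<alpha> > 1" "\<alpha> + inverse \<alpha> = of_int (theta \<alpha>)" "theta \<alpha> \<ge> 3"
    using key[OF \<theta>] \<theta>(1) by auto
qed

text \<open>Multiplying by Q on the right turns the definition into Q diag = M Q, an equation
  between columns. Compatible pairs are handled through this eigenvector form from here on.\<close>

lemma real_N_eq_iff:
  assumes "wedge b a \<noteq> 0"
  shows "real_N \<alpha> a b = M \<longleftrightarrow> M *v a = \<alpha> *s a \<and> M *v b = inverse \<alpha> *s b"
proof -
  let ?Q = "Q_mat a b"
  have "det ?Q \<noteq> 0"
    using assms by (simp add: Q_mat_def det_2 transpose_def wedge_def vector_2 algebra_simps)
  then have "invertible ?Q" by (simp add: invertible_det_nz)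
  then have Q: "?Q ** matrix_inv ?Q = mat 1" "matrix_inv ?Q ** ?Q = mat 1"
    unfolding matrix_inv_def invertible_def by (metis (mono_tags, lifting) someI_ex)+
  have "real_N \<alpha> a b = M \<longleftrightarrow> ?Q ** diag_mat \<alpha> = M ** ?Q"
  proof
    assume "real_N \<alpha> a b = M"
    then show "?Q ** diag_mat \<alpha> = M ** ?Q"
      unfolding real_N_def using Q by (metis matrix_mul_assoc matrix_mul_rid)
  next
    assume "?Q ** diag_mat \<alpha> = M ** ?Q"
    then show "real_N \<alpha> a b = M"
      unfolding real_N_def using Q by (metis matrix_mul_assoc matrix_mul_rid)
  qed
  also have "\<dots> \<longleftrightarrow> M *v a = \<alpha> *s a \<and> M *v b = inverse \<alpha> *s b"
    by (auto simp: vec2_simps Q_mat_def transpose_def diag_mat_def vector_2 mult.commute)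
  finally show ?thesis .
qed

lemma real_mat_inject: "real_mat M = real_mat M' \<longleftrightarrow> M = M'"
  by (simp add: vec_eq_iff)

lemma wedge_eq_0_iff:
  assumes "b \<noteq> 0"
  shows "wedge b a = 0 \<longleftrightarrow> (\<exists>k. a = k *\<^sub>R b)"
proof
  assume w: "wedge b a = 0"
  from assms consider "b$1 \<noteq> 0" | "b$2 \<noteq> 0" by (auto simp: vec_eq_iff forall_2)
  then show "\<exists>k. a = k *\<^sub>R b"
  proof cases
    case 1
    then show ?thesis using w
      by (intro exI[of _ "a$1 / b$1"]) (auto simp: vec_eq_iff forall_2 wedge_def field_simps)
  next
    case 2
    then show ?thesis using w
      by (intro exI[of _ "a$2 / b$2"]) (auto simp: vec_eq_iff forall_2 wedge_def field_simps)
  qed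
qed (auto simp: wedge_def)

lemma independent_pair_iff_wedge: "a \<noteq> b \<and> independent {a, b} \<longleftrightarrow> wedge b a \<noteq> 0"
proof (cases "b = 0")
  case True
  then show ?thesis by (auto simp: wedge_def dependent_zero)
next
  case False
  moreover have "wedge b b = 0" by (simp add: wedge_def)
  ultimately show ?thesis
    using wedge_eq_0_iff[OF False, of a] by (auto simp: independent_insert span_singleton intro: exI[of _ 1])
qed

lemma compatible_pairs_iff:
  "(a, b) \<in> compatible_pairs \<alpha> \<longleftrightarrow> wedge b a \<noteq> 0 \<and>
     (\<exists>N. real_mat N *v a = \<alpha> *s a \<and> real_mat N *v b = inverse \<alpha> *s b)"
proof -
  have "(\<forall>i j. M $ i $ j \<in> \<int>) \<longleftrightarrow> (\<exists>N. M = real_mat N)" for M :: "real^2^2"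
  proof
    assume M: "\<forall>i j. M $ i $ j \<in> \<int>"
    have "M = real_mat (map_matrix floor M)"
      using M by (auto simp: vec_eq_iff of_int_floor)
    then show "\<exists>N. M = real_mat N" by blast
  qed auto
  then show ?thesis
    unfolding compatible_pairs_def using independent_pair_iff_wedge[of a b]
    by (auto simp: real_N_eq_iff)
qed

lemma N_mat_eqI:
  assumes "wedge b a \<noteq> 0" "real_mat N *v a = \<alpha> *s a" "real_mat N *v b = inverse \<alpha> *s b"
  shows "N_mat \<alpha> a b = N"
proof -
  have "real_N \<alpha> a b = real_mat N"
    using assms by (simp add: real_N_eq_iff)
  then show ?thesis
    unfolding N_mat_def by (simp add: real_mat_inject)
qed

lemma compatible_pairsD:
  assumes "(a, b) \<in> compatible_pairs \<alpha>"
  shows "wedge b a \<noteq> 0" "real_mat (N_mat \<alpha> a b) *v a = \<alpha> *s a"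
    "real_mat (N_mat \<alpha> a b) *v b = inverse \<alpha> *s b"
  using assms N_mat_eqI by (auto simp: compatible_pairs_iff)

text \<open>Both values are read off from the wedge, with the eigenvalues known: (Nb) ^ (Na) is the
  determinant times b ^ a, and (Nb) ^ a + b ^ (Na) is the trace times b ^ a.\<close>

lemma det_trace_N_mat:
  assumes "S_plus_admissible \<alpha>" "(a, b) \<in> compatible_pairs \<alpha>"
  defines "N \<equiv> N_mat \<alpha> a b"
  shows "det N = 1" "N$1$1 + N$2$2 = theta \<alpha>"
proof -
  note \<alpha> = S_plus_admissibleD[OF assms(1)] and ab = compatible_pairsD[OF assms(2), folded N_def]
  have e: "N$1$1 * a$1 + N$1$2 * a$2 = \<alpha> * a$1" "N$2$1 * a$1 + N$2$2 * a$2 = \<alpha> * a$2"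
    "N$1$1 * b$1 + N$1$2 * b$2 = inverse \<alpha> * b$1" "N$2$1 * b$1 + N$2$2 * b$2 = inverse \<alpha> * b$2"
    using ab(2,3) by (auto simp: vec2_simps)
  have "(N$1$1 * N$2$2 - N$1$2 * N$2$1) * wedge b a = (inverse \<alpha> * \<alpha>) * wedge b a"
    unfolding wedge_def of_int_diff of_int_mult using e by algebra
  then have "real_of_int (N$1$1 * N$2$2 - N$1$2 * N$2$1) = 1"
    using ab(1) \<alpha>(1) by simp
  then show "det N = 1"
    by (metis det_2 of_int_eq_1_iff)
  have "(N$1$1 + N$2$2) * wedge b a = (\<alpha> + inverse \<alpha>) * wedge b a"
    unfolding wedge_def of_int_add using e by algebra
  then have "real_of_int (N$1$1 + N$2$2) = of_int (theta \<alpha>)"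
    using ab(1) \<alpha>(2) by simp
  then show "N$1$1 + N$2$2 = theta \<alpha>"
    using of_int_eq_iff by blast
qed

section \<open>The invariant \<open>p\<close> of a vector \<open>c\<close>\<close>

lemma p_eq_unique:
  assumes "(a, b) \<in> compatible_pairs \<alpha>" "r \<ge> 1" "p_eq \<alpha> r a b c p" "p_eq \<alpha> r a b c p'"
  shows "p = p'"
  using assms(2-) compatible_pairsD(1)[OF assms(1)]
  by (auto simp: p_eq_def real_vec_def vec_eq_iff)

lemma p_of_eqI:
  assumes "(a, b) \<in> compatible_pairs \<alpha>" "r \<ge> 1" "p_eq \<alpha> r a b c p"
  shows "p_of \<alpha> r a b c = p"
  unfolding p_of_def using assms p_eq_unique by blast

lemma p_eq_p_of:
  assumes "(a, b) \<in> compatible_pairs \<alpha>" "r \<ge> 1" "c \<in> C_set \<alpha> r a b"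
  shows "p_eq \<alpha> r a b c (p_of \<alpha> r a b c)"
  using assms p_of_eqI by (auto simp: C_set_def)

text \<open>The determinant of I - N is 1 - trace + det = 2 - \<open>theta \<alpha>\<close> = -d,
  and \<open>theta \<alpha>\<close> is at least 3.\<close>

lemma invertible_one_minus_N:
  assumes "S_plus_admissible \<alpha>" "(a, b) \<in> compatible_pairs \<alpha>"
  shows "invertible (mat 1 - real_mat (N_mat \<alpha> a b))"
proof -
  let ?N = "N_mat \<alpha> a b"
  note \<alpha> = S_plus_admissibleD[OF assms(1)] and dt = det_trace_N_mat[OF assms]
  have "det (mat 1 - real_mat ?N) = of_int (1 - (?N$1$1 + ?N$2$2) + det ?N)"
    by (simp add: det_2 mat_def algebra_simps)
  also have "\<dots> = of_int (2 - theta \<alpha>)" by (simp add: dt)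
  finally show ?thesis using \<alpha>(3) by (simp add: invertible_det_nz)
qed

lemma p_eq_cancel:
  assumes "S_plus_admissible \<alpha>" "(a, b) \<in> compatible_pairs \<alpha>" "p_eq \<alpha> r a b c p" "p_eq \<alpha> r a b c' p"
  shows "c = c'"
proof -
  let ?M = "mat 1 - real_mat (N_mat \<alpha> a b)"
  have "?M *v (c - half_prod a b) = ?M *v (c' - half_prod a b)"
    using assms(3,4) unfolding p_eq_def by (metis diff_add_cancel)
  then have "c - half_prod a b = c' - half_prod a b"
    using invertible_one_minus_N[OF assms(1,2)]
    by (metis invertible_def matrix_vector_mul_assoc matrix_vector_mul_lid)
  then show ?thesis by simp
qed

lemma ex_p_eq:
  assumes "S_plus_admissible \<alpha>" "(a, b) \<in> compatible_pairs \<alpha>"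
  shows "\<exists>c. p_eq \<alpha> r a b c p"
proof -
  let ?M = "mat 1 - real_mat (N_mat \<alpha> a b)"
  obtain M' where "?M ** M' = mat 1"
    using invertible_one_minus_N[OF assms] by (auto simp: invertible_def)
  then have "?M *v (M' *v y) = y" for y
    by (simp add: matrix_vector_mul_assoc)
  then show ?thesis
    unfolding p_eq_def
    by (intro exI[of _ "half_prod a b + M' *v ((wedge b a / real r) *\<^sub>R real_vec p
      + (wedge b a / 2) *\<^sub>R row_prods (N_mat \<alpha> a b))"]) simp
qed

lemma p_eq_translate:
  assumes "p_eq \<alpha> r a b c p"
  shows "p_eq \<alpha> r a b (c + (wedge b a / real r) *\<^sub>R real_vec m) (p + (mat 1 - N_mat \<alpha> a b) *v m)"
  using assms unfolding p_eq_def
  by (simp add: vec2_simps algebra_simps add_divide_distrib diff_divide_distrib)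

lemma real_vec_add: "real_vec (m + n) = real_vec m + real_vec n"
  and real_vec_diff: "real_vec (m - n) = real_vec m - real_vec n"
  and real_vec_0 [simp]: "real_vec 0 = 0"
  by (simp_all add: real_vec_def vec_eq_iff)

lemma c_class_eq_iff:
  "c_class r a b c = c_class r a b c' \<longleftrightarrow> (\<exists>m. c' = c + (wedge b a / real r) *\<^sub>R real_vec m)"
proof
  assume "c_class r a b c = c_class r a b c'"
  moreover have "c' = c' + (wedge b a / real r) *\<^sub>R real_vec 0"
    by simp
  ultimately show "\<exists>m. c' = c + (wedge b a / real r) *\<^sub>R real_vec m"
    unfolding c_class_def by blast
next
  assume "\<exists>m. c' = c + (wedge b a / real r) *\<^sub>R real_vec m"
  then obtain m where m: "c' = c + (wedge b a / real r) *\<^sub>R real_vec m" by blast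
  have "c + (wedge b a / real r) *\<^sub>R real_vec n = c' + (wedge b a / real r) *\<^sub>R real_vec (n - m)"
    "c' + (wedge b a / real r) *\<^sub>R real_vec n = c + (wedge b a / real r) *\<^sub>R real_vec (n + m)" for n
    by (simp_all add: m real_vec_diff real_vec_add algebra_simps)
  then show "c_class r a b c = c_class r a b c'"
    unfolding c_class_def by blast
qed

lemma t_class_eq_iff:
  "t_class r a b t = t_class r a b t' \<longleftrightarrow> (\<exists>m. t' = t + of_real (wedge b a / real r * real_of_int m))"
proof
  assume "t_class r a b t = t_class r a b t'"
  moreover have "t' = t' + of_real (wedge b a / real r * real_of_int 0)"
    by simp
  ultimately show "\<exists>m. t' = t + of_real (wedge b a / real r * real_of_int m)"
    unfolding t_class_def by blast
next
  assume "\<exists>m. t' = t + of_real (wedge b a / real r * real_of_int m)"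
  then obtain m where m: "t' = t + of_real (wedge b a / real r * real_of_int m)" by blast
  have "t + of_real (wedge b a / real r * real_of_int n) = t' + of_real (wedge b a / real r * real_of_int (n - m))"
    "t' + of_real (wedge b a / real r * real_of_int n) = t + of_real (wedge b a / real r * real_of_int (n + m))" for n
    by (simp_all add: m ring_distribs diff_divide_distrib add_divide_distrib)
  then show "t_class r a b t = t_class r a b t'"
    unfolding t_class_def by blast
qed

lemma c_class_eq_iff_p:
  assumes "S_plus_admissible \<alpha>" "(a, b) \<in> compatible_pairs \<alpha>" "r \<ge> 1"
    "p_eq \<alpha> r a b c p" "p_eq \<alpha> r a b c' p'"
  shows "c_class r a b c = c_class r a b c' \<longleftrightarrow> (\<exists>m. p' = p + (mat 1 - N_mat \<alpha> a b) *v m)"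
  unfolding c_class_eq_iff
  using p_eq_translate[OF assms(4)] assms p_eq_unique p_eq_cancel by metis

section \<open>Integer matrices and transformed pairs\<close>

lemma real_mat_mult: "real_mat (K ** L) = real_mat K ** real_mat L"
  by (simp add: vec_eq_iff matrix_matrix_mult_def)

lemma real_mat_one [simp]: "real_mat (mat 1) = mat 1"
  by (simp add: vec_eq_iff mat_def)

lemma real_vec_mult: "real_vec (K *v m) = real_mat K *v real_vec m"
  by (simp add: vec_eq_iff matrix_vector_mult_def real_vec_def)

lemma real_vec_smult: "real_vec (z *s m) = of_int z *\<^sub>R real_vec m"
  by (simp add: vec_eq_iff real_vec_def)

lemma GL2Z_inverse:
  assumes "K \<in> GL2Z"
  obtains K' where "K' \<in> GL2Z" "K ** K' = mat 1" "K' ** K = mat 1"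
  using assms by (auto simp: GL2Z_def invertible_def)

lemma GL2Z_mult: "K \<in> GL2Z \<Longrightarrow> L \<in> GL2Z \<Longrightarrow> K ** L \<in> GL2Z"
  by (simp add: GL2Z_def invertible_mult)

lemma one_GL2Z: "mat 1 \<in> GL2Z"
  by (auto simp: GL2Z_def invertible_def intro: exI[of _ "mat 1"])

lemma det_GL2Z: assumes "K \<in> GL2Z" shows "det K * det K = 1" "det K \<noteq> 0"
proof -
  obtain K' where "K ** K' = mat 1" using assms by (auto simp: GL2Z_def invertible_def)
  then have "det K * det K' = 1" by (metis det_mul det_I)
  then show "det K * det K = 1" "det K \<noteq> 0"
    by (auto simp: zmult_eq_1_iff)
qed

lemma matrix_inv_eqI:
  fixes K :: "int^2^2"
  assumes "K ** K' = mat 1" "K' ** K = mat 1"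
  shows "matrix_inv K = K'"
proof -
  have "\<exists>A. K ** A = mat 1 \<and> A ** K = mat 1" using assms by blast
  then have inv: "K ** matrix_inv K = mat 1 \<and> matrix_inv K ** K = mat 1"
    unfolding matrix_inv_def by (rule someI_ex)
  have "matrix_inv K = matrix_inv K ** (K ** K')" by (simp add: assms)
  also have "\<dots> = K'" using inv by (simp only: matrix_mul_assoc matrix_mul_lid)
  finally show ?thesis .
qed

lemma wedge_real_mat: "wedge (real_mat K *v b) (real_mat K *v a) = of_int (det K) * wedge b a"
  by (simp add: wedge_def matrix_vector_mult_def sum_2 det_2 algebra_simps)

lemma wedge_scaleR: "wedge (\<rho> *\<^sub>R b) (\<mu> *\<^sub>R a) = \<mu> * \<rho> * wedge b a"
  by (simp add: wedge_def algebra_simps)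

text \<open>An explicit two-sided inverse \<open>K'\<close> stands in for \<open>matrix_inv\<close>,
  and \<mu>, \<rho> may have any sign, so that one statement serves scalings, GL(2,Z) and their
  combination.\<close>

lemma compatible_pairs_transform:
  assumes ab: "(a, b) \<in> compatible_pairs \<alpha>" and K: "K ** K' = mat 1" "K' ** K = mat 1"
    and "\<mu> \<noteq> 0" "\<rho> \<noteq> 0"
  defines "A \<equiv> \<mu> *\<^sub>R (real_mat K *v a)" and "B \<equiv> \<rho> *\<^sub>R (real_mat K *v b)"
  shows "(A, B) \<in> compatible_pairs \<alpha>" "N_mat \<alpha> A B = K ** N_mat \<alpha> a b ** K'"
proof -
  note ab = compatible_pairsD[OF ab]
  let ?N = "N_mat \<alpha> a b"
  have KN: "real_mat (K ** ?N ** K') *v (real_mat K *v x) = real_mat K *v (real_mat ?N *v x)" for x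
  proof -
    have "(K ** ?N ** K') ** K = K ** ?N"
      using K by (metis matrix_mul_assoc matrix_mul_rid)
    then show ?thesis
      by (metis matrix_vector_mul_assoc real_mat_mult)
  qed
  have "K \<in> GL2Z" using K by (auto simp: GL2Z_def invertible_def)
  then have w: "wedge B A \<noteq> 0"
    using assms(4,5) ab(1) det_GL2Z(2) by (simp add: A_def B_def wedge_scaleR wedge_real_mat)
  have A: "real_mat (K ** ?N ** K') *v A = \<alpha> *s A" "real_mat (K ** ?N ** K') *v B = inverse \<alpha> *s B"
    unfolding A_def B_def
    by (simp_all add: matrix_vector_mult_scaleR KN ab scalar_mult_eq_scaleR)
  show "(A, B) \<in> compatible_pairs \<alpha>"
    using w A by (auto simp: compatible_pairs_iff)
  show "N_mat \<alpha> A B = K ** ?N ** K'"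
    by (rule N_mat_eqI[OF w A])
qed

lemma compatible_pairs_GL2Z:
  assumes "(a, b) \<in> compatible_pairs \<alpha>" "K \<in> GL2Z"
  defines "A \<equiv> real_mat K *v a" and "B \<equiv> real_mat K *v b"
  shows "(A, B) \<in> compatible_pairs \<alpha>" "N_mat \<alpha> A B ** K = K ** N_mat \<alpha> a b"
proof -
  obtain K' where K': "K ** K' = mat 1" "K' ** K = mat 1"
    using GL2Z_inverse[OF assms(2)] .
  have *: "(A, B) \<in> compatible_pairs \<alpha>" "N_mat \<alpha> A B = K ** N_mat \<alpha> a b ** K'"
    using compatible_pairs_transform[OF assms(1) K', of 1 1] by (simp_all add: A_def B_def)
  show "(A, B) \<in> compatible_pairs \<alpha>" by fact
  show "N_mat \<alpha> A B ** K = K ** N_mat \<alpha> a b"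
    using *(2) K' by (metis matrix_mul_assoc matrix_mul_rid)
qed

lemma compatible_pairs_scale:
  assumes "(a, b) \<in> compatible_pairs \<alpha>" "\<mu> \<noteq> 0" "\<rho> \<noteq> 0"
  shows "(\<mu> *\<^sub>R a, \<rho> *\<^sub>R b) \<in> compatible_pairs \<alpha>" "N_mat \<alpha> (\<mu> *\<^sub>R a) (\<rho> *\<^sub>R b) = N_mat \<alpha> a b"
  using compatible_pairs_transform[OF assms(1), of "mat 1" "mat 1" \<mu> \<rho>] assms by simp_all

section \<open>Effect of the three actions on \<open>p\<close>\<close>

lemma consecutive_product_even: "\<exists>j. k * (k - 1) = 2 * j" for k :: int
proof -
  have "even (k * (k - 1))" by simp
  then show ?thesis by (simp add: dvd_def)
qed

text \<open>When a row of \<open>K ** L\<close> is expanded, the squares of entries of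
  \<open>K\<close> agree with the entries modulo 2, and the mixed term has the coefficient L11 L22 +
  L12 L21 = det L + 2 L12 L21. The vector \<open>m\<close> collects the halves of these even
  errors.\<close>

lemma row_prods_mult:
  "\<exists>m. row_prods (K ** L) =
     real_mat K *v row_prods L + of_int (det L) *\<^sub>R row_prods K + 2 *\<^sub>R real_vec m"
proof -
  have "\<exists>j. K$i$l * (K$i$l - 1) = 2 * j" for i l by (rule consecutive_product_even)
  then obtain J where J: "\<And>i l. K$i$l * (K$i$l - 1) = 2 * J i l" by metis
  define m :: "int^2" where
    "m = (\<chi> i. J i 1 * L$1$1 * L$1$2 + J i 2 * L$2$1 * L$2$2 + K$i$1 * K$i$2 * L$1$2 * L$2$1)"
  have "(K ** L)$i$1 * (K ** L)$i$2 =
      (K$i$1 * (L$1$1 * L$1$2) + K$i$2 * (L$2$1 * L$2$2)) + det L * (K$i$1 * K$i$2) + 2 * m$i" for i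
  proof -
    have "2 * m$i = (2 * J i 1) * L$1$1 * L$1$2 + (2 * J i 2) * L$2$1 * L$2$2
        + 2 * K$i$1 * K$i$2 * L$1$2 * L$2$1"
      by (simp add: m_def)
    then show ?thesis
      unfolding J[symmetric] by (simp add: matrix_matrix_mult_def sum_2 det_2 algebra_simps)
  qed
  from this[THEN arg_cong[where f = real_of_int]]
  have "row_prods (K ** L) =
     real_mat K *v row_prods L + of_int (det L) *\<^sub>R row_prods K + 2 *\<^sub>R real_vec m"
    by (simp add: vec_eq_iff row_prods_def real_vec_def matrix_vector_mult_def sum_2)
  then show ?thesis by blast
qed

definition K_dot_c :: "int^2^2 \<Rightarrow> real^2 \<Rightarrow> real^2 \<Rightarrow> real^2 \<Rightarrow> real^2" where
  "K_dot_c K a b c = half_prod (real_mat K *v a) (real_mat K *v b)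
     + real_mat K *v (c - half_prod a b) + (wedge b a / 2) *\<^sub>R row_prods K"

lemma K_rep_simp:
  "K_rep K ((a, b, c), t) = ((real_mat K *v a, real_mat K *v b, K_dot_c K a b c), t)"
  by (simp add: K_rep_def K_dot_c_def Let_def)

text \<open>Both \<open>K ** N\<close> and \<open>N' ** K\<close> are expanded by the cocycle identity; as they agree, the
  half-integral contributions to \<open>p\<close> cancel modulo \<open>r\<close>.\<close>

lemma p_eq_K:
  assumes "S_plus_admissible \<alpha>" "(a, b) \<in> compatible_pairs \<alpha>" "r \<ge> 1" "K \<in> GL2Z" "p_eq \<alpha> r a b c p"
  shows "\<exists>n. p_eq \<alpha> r (real_mat K *v a) (real_mat K *v b) (K_dot_c K a b c)
    (det K *s (K *v p) + int r *s n)"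
proof -
  define N where "N = N_mat \<alpha> a b"
  define N' where "N' = N_mat \<alpha> (real_mat K *v a) (real_mat K *v b)"
  define w where "w = wedge b a"
  define \<epsilon> where "\<epsilon> = real_of_int (det K)"
  define x where "x = c - half_prod a b"
  have \<epsilon>: "\<epsilon> * \<epsilon> = 1" 
    using det_GL2Z(1)[OF assms(4)] unfolding \<epsilon>_def by (metis of_int_1 of_int_mult)
  have NK: "N' ** K = K ** N"
    using compatible_pairs_GL2Z(2)[OF assms(2,4)] by (simp add: N_def N'_def)
  have rNK: "real_mat N' *v (real_mat K *v y) = real_mat K *v (real_mat N *v y)" for y
    by (metis NK real_mat_mult matrix_vector_mul_assoc)
  \<comment> \<open>Since det N = 1, the coefficient of \<open>row_prods K\<close> is 1 here,
    whereas it is \<open>\<epsilon>\<close> for \<open>row_prods N'\<close> in the other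
    expansion.\<close>
  obtain m1 where m1: "row_prods (K ** N) = real_mat K *v row_prods N + row_prods K + 2 *\<^sub>R real_vec m1"
    using row_prods_mult[of K N] det_trace_N_mat(1)[OF assms(1,2)] by (auto simp: N_def)
  obtain m2 where m2: "row_prods (K ** N) =
      real_mat N' *v row_prods K + \<epsilon> *\<^sub>R row_prods N' + 2 *\<^sub>R real_vec m2"
    using row_prods_mult[of N' K] NK by (auto simp: \<epsilon>_def)
  have p: "x - real_mat N *v x - (w / 2) *\<^sub>R row_prods N = (w / real r) *\<^sub>R real_vec p"
    using assms(5) by (simp add: p_eq_def N_def w_def x_def matrix_vector_mult_diff_rdistrib)
  then have "real_mat K *v (x - real_mat N *v x - (w / 2) *\<^sub>R row_prods N)
      = real_mat K *v ((w / real r) *\<^sub>R real_vec p)" by simp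
  then have Kp: "real_mat K *v x - real_mat K *v (real_mat N *v x) =
      (w / 2) *\<^sub>R (real_mat K *v row_prods N) + (w / real r) *\<^sub>R (real_mat K *v real_vec p)"
    by (simp add: matrix_vector_mult_diff_distrib matrix_vector_mult_scaleR algebra_simps)
  have rp: "(w / 2) *\<^sub>R (real_mat K *v row_prods N) + (w / 2) *\<^sub>R row_prods K
      - (w / 2) *\<^sub>R (real_mat N' *v row_prods K) - (\<epsilon> * w / 2) *\<^sub>R row_prods N' = w *\<^sub>R (real_vec (m2 - m1))"
  proof -
    have "(w / 2) *\<^sub>R (real_mat K *v row_prods N + row_prods K + 2 *\<^sub>R real_vec m1) =
      (w / 2) *\<^sub>R (real_mat N' *v row_prods K + \<epsilon> *\<^sub>R row_prods N' + 2 *\<^sub>R real_vec m2)"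
      using m1 m2 by simp
    then show ?thesis by (simp add: real_vec_diff algebra_simps)
  qed
  define n where "n = det K *s (m2 - m1)"
  have "p_eq \<alpha> r (real_mat K *v a) (real_mat K *v b) (K_dot_c K a b c)
    (det K *s (K *v p) + int r *s n)"
    unfolding p_eq_def N'_def[symmetric] wedge_real_mat \<epsilon>_def[symmetric] w_def[symmetric]
  proof -
    have "(mat 1 - real_mat N') *v (K_dot_c K a b c - half_prod (real_mat K *v a) (real_mat K *v b))
       - (\<epsilon> * w / 2) *\<^sub>R row_prods N' =
      (real_mat K *v x - real_mat K *v (real_mat N *v x)) + (w / 2) *\<^sub>R row_prods K
       - (w / 2) *\<^sub>R (real_mat N' *v row_prods K) - (\<epsilon> * w / 2) *\<^sub>R row_prods N'"
      by (simp add: K_dot_c_def x_def[symmetric] w_def[symmetric] matrix_vector_mult_diff_rdistrib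
        matrix_vector_right_distrib matrix_vector_mult_scaleR rNK algebra_simps)
    also have "\<dots> = (w / real r) *\<^sub>R (real_mat K *v real_vec p) + w *\<^sub>R (real_vec (m2 - m1))"
      unfolding Kp rp[symmetric] by (simp add: algebra_simps)
    \<comment> \<open>The unit for the new pair is \<epsilon> w / r: one factor of \<epsilon> *
      \<epsilon> = 1 is spent on it, the other becomes the sign \<open>det K\<close> in front of
      \<open>K *v p\<close>.\<close>
    also have "\<dots> = (\<epsilon> * \<epsilon> * w / real r) *\<^sub>R (real_mat K *v real_vec p) + (\<epsilon> * \<epsilon> * w) *\<^sub>R (real_vec (m2 - m1))"
      by (simp add: \<epsilon>)
    also have "\<dots> = (\<epsilon> * w / real r) *\<^sub>R real_vec (det K *s (K *v p) + int r *s n)"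
      unfolding n_def real_vec_add real_vec_smult real_vec_mult \<epsilon>_def[symmetric] scaleR_add_right scaleR_scaleR
      using assms(3) by (simp add: mult_ac)
    finally show "(mat 1 - real_mat N') *v (K_dot_c K a b c - half_prod (real_mat K *v a) (real_mat K *v b))
       - (\<epsilon> * w / 2) *\<^sub>R row_prods N' = (\<epsilon> * w / real r) *\<^sub>R real_vec (det K *s (K *v p) + int r *s n)" .
  qed
  then show ?thesis by blast
qed

text \<open>I - N multiplies \<open>b\<close> by (\<alpha> - 1)/\<alpha> and \<open>a\<close> by 1 -
  \<alpha>; the coefficients in \<open>k_dot_c\<close> cancel exactly these eigenvalues, so the
  change is (kb) a - (ka) b.\<close>

lemma p_eq_k:
  assumes "S_plus_admissible \<alpha>" "(a, b) \<in> compatible_pairs \<alpha>" "r \<ge> 1" "p_eq \<alpha> r a b c p"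
  shows "p_eq \<alpha> r a b (k_dot_c \<alpha> k a b c) (p + int r *s vector [- k$2, k$1])"
proof -
  note \<alpha> = S_plus_admissibleD(1)[OF assms(1)] and ab = compatible_pairsD[OF assms(2)]
  let ?M = "mat 1 - real_mat (N_mat \<alpha> a b)"
  have e: "?M *v a = (1 - \<alpha>) *\<^sub>R a" "?M *v b = (1 - inverse \<alpha>) *\<^sub>R b"
    using ab by (simp_all add: matrix_vector_mult_diff_rdistrib scalar_mult_eq_scaleR scaleR_diff_left)
  have "?M *v (k_dot_c \<alpha> k a b c - half_prod a b) = ?M *v (c - half_prod a b)
    - (\<alpha> * row_times k a / (\<alpha> - 1)) *\<^sub>R (?M *v b) - (row_times k b / (\<alpha> - 1)) *\<^sub>R (?M *v a)"
    by (simp add: k_dot_c_def matrix_vector_mult_diff_distrib matrix_vector_mult_scaleR)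
  also have "\<dots> = ?M *v (c - half_prod a b) - row_times k a *\<^sub>R b + row_times k b *\<^sub>R a"
  proof -
    have "\<alpha> * row_times k a / (\<alpha> - 1) * (1 - inverse \<alpha>) = row_times k a"
      "row_times k b / (\<alpha> - 1) * (1 - \<alpha>) = - row_times k b"
      using \<alpha> by (simp_all add: field_simps)
    then show ?thesis unfolding e by (simp only: scaleR_scaleR) simp
  qed
  \<comment> \<open>In coordinates, (kb) a - (ka) b is \<open>wedge b a\<close> times (-k2, k1),
    which is r times that vector in units of w/r.\<close>
  also have "row_times k b *\<^sub>R a = row_times k a *\<^sub>R b + (wedge b a / real r) *\<^sub>R real_vec (int r *s vector [- k$2, k$1])"
  proof -
    have "(wedge b a / real r) *\<^sub>R real_vec (int r *s vector [- k$2, k$1])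
        = wedge b a *\<^sub>R real_vec (vector [- k$2, k$1])"
      using assms(3) by (simp add: real_vec_smult)
    then show ?thesis
      by (simp add: vec_eq_iff forall_2 real_vec_def row_times_def wedge_def vector_2 algebra_simps)
  qed
  finally have "?M *v (k_dot_c \<alpha> k a b c - half_prod a b) = ?M *v (c - half_prod a b)
      + (wedge b a / real r) *\<^sub>R real_vec (int r *s vector [- k$2, k$1])"
    by simp
  moreover have "?M *v (c - half_prod a b)
      = (wedge b a / real r) *\<^sub>R real_vec p + (wedge b a / 2) *\<^sub>R row_prods (N_mat \<alpha> a b)"
    using assms(4) by (simp only: p_eq_def diff_eq_eq)
  ultimately show ?thesis
    by (simp add: p_eq_def real_vec_add scaleR_add_right)
qed

text \<open>Every term of the defining equation is homogeneous of degree one in each of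
  \<open>a\<close> and \<open>b\<close>, once \<open>c\<close> is scaled by their product, and
  \<open>N\<close> depends only on the two eigenlines.\<close>

lemma p_eq_scale:
  assumes "(a, b) \<in> compatible_pairs \<alpha>" "p_eq \<alpha> r a b c p" "\<mu> \<noteq> 0" "\<rho> \<noteq> 0"
  shows "p_eq \<alpha> r (\<mu> *\<^sub>R a) (\<rho> *\<^sub>R b) ((\<mu> * \<rho>) *\<^sub>R c) p"
proof -
  have "half_prod (\<mu> *\<^sub>R a) (\<rho> *\<^sub>R b) = (\<mu> * \<rho>) *\<^sub>R half_prod a b"
    by (simp add: half_prod_def vec_eq_iff)
  moreover have "(\<mu> * \<rho>) *\<^sub>R ((mat 1 - real_mat (N_mat \<alpha> a b)) *v (c - half_prod a b)
       - (wedge b a / 2) *\<^sub>R row_prods (N_mat \<alpha> a b)) = (\<mu> * \<rho>) *\<^sub>R ((wedge b a / real r) *\<^sub>R real_vec p)"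
    using assms(2) unfolding p_eq_def by simp
  ultimately show ?thesis
    unfolding p_eq_def wedge_scaleR compatible_pairs_scale(2)[OF assms(1,3,4)]
    by (simp add: matrix_vector_mult_diff_distrib matrix_vector_mult_scaleR scaleR_diff_right)
qed

section \<open>The actions on classes\<close>

lemma in_A_set_iff:
  "((a, b, c), t) \<in> A_set \<alpha> r \<longleftrightarrow> (a, b) \<in> compatible_pairs \<alpha> \<and> (\<exists>p. p_eq \<alpha> r a b c p)"
  by (auto simp: A_set_def T_set_def C_set_def)

lemma quad_class_eq_iff:
  "quad_class r ((a, b, c), t) = quad_class r ((a', b', c'), t') \<longleftrightarrow>
     a' = a \<and> b' = b \<and> c_class r a b c = c_class r a b c' \<and> t_class r a b t = t_class r a b t'"
  by (auto simp: quad_class_def)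

lemma quad_class_eqI:
  assumes "c' = c + (wedge b a / real r) *\<^sub>R real_vec m"
    "t' = t + of_real (wedge b a / real r * real_of_int n)"
  shows "quad_class r ((a, b, c), t) = quad_class r ((a, b, c'), t')"
  using assms unfolding quad_class_eq_iff c_class_eq_iff t_class_eq_iff by blast

lemma quad_class_eqE:
  assumes "quad_class r ((a, b, c), t) = quad_class r q"
  obtains m n where "q = ((a, b, c + (wedge b a / real r) *\<^sub>R real_vec m),
    t + of_real (wedge b a / real r * real_of_int n))"
proof -
  obtain a' b' c' t' where "q = ((a', b', c'), t')" by (metis prod.collapse)
  with assms that show ?thesis
    by (auto simp: quad_class_eq_iff c_class_eq_iff t_class_eq_iff)
qed

lemma K_rep_in_A_set:
  assumes "S_plus_admissible \<alpha>" "r \<ge> 1" "K \<in> GL2Z" "q \<in> A_set \<alpha> r"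
  shows "K_rep K q \<in> A_set \<alpha> r"
proof -
  obtain a b c t where "q = ((a, b, c), t)" by (metis prod.collapse)
  with assms(4) show ?thesis
    using p_eq_K[OF assms(1) _ assms(2,3)] compatible_pairs_GL2Z(1)[OF _ assms(3)]
    by (simp add: in_A_set_iff K_rep_simp) blast
qed

lemma k_rep_in_A_set:
  assumes "S_plus_admissible \<alpha>" "r \<ge> 1" "q \<in> A_set \<alpha> r"
  shows "k_rep \<alpha> k q \<in> A_set \<alpha> r"
proof -
  obtain a b c t where "q = ((a, b, c), t)" by (metis prod.collapse)
  with assms(3) show ?thesis
    using p_eq_k[OF assms(1) _ assms(2)] by (simp add: in_A_set_iff k_rep_def) blast
qed

lemma scale_rep_in_A_set:
  assumes "\<mu> \<noteq> 0" "\<rho> \<noteq> 0" "q \<in> A_set \<alpha> r"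
  shows "scale_rep (\<mu>, \<rho>) q \<in> A_set \<alpha> r"
proof -
  obtain a b c t where "q = ((a, b, c), t)" by (metis prod.collapse)
  then show ?thesis
    using assms p_eq_scale[of a b \<alpha> r c _ \<mu> \<rho>] compatible_pairs_scale(1)[of a b \<alpha> \<mu> \<rho>]
    by (auto simp: in_A_set_iff scale_rep_def)
qed

lemma K_rep_cong:
  assumes "K \<in> GL2Z" "quad_class r q = quad_class r q'"
  shows "quad_class r (K_rep K q) = quad_class r (K_rep K q')"
proof -
  obtain a b c t where q: "q = ((a, b, c), t)" by (metis prod.collapse)
  with assms(2) obtain m n where q': "q' = ((a, b, c + (wedge b a / real r) *\<^sub>R real_vec m),
    t + of_real (wedge b a / real r * real_of_int n))"
    using quad_class_eqE by blast
  have \<epsilon>: "real_of_int (det K) * real_of_int (det K) = 1"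
    using det_GL2Z(1)[OF assms(1)] by (metis of_int_1 of_int_mult)
  have \<epsilon>2: "real_of_int (det K) * (real_of_int (det K) * x) = x" for x
    using \<epsilon> by (simp flip: mult.assoc)
  show ?thesis
    unfolding q q' K_rep_simp
    \<comment> \<open>The lattice step of the pair (Ka, Kb) is det K times the old one, so the
      coefficients pick up \<open>det K\<close>, which is its own inverse.\<close>
    by (rule quad_class_eqI[where m = "det K *s (K *v m)" and n = "det K * n"])
      (simp_all add: K_dot_c_def wedge_real_mat real_vec_smult real_vec_mult \<epsilon> \<epsilon>2 mult.assoc
        matrix_vector_right_distrib matrix_vector_mult_diff_distrib matrix_vector_mult_scaleR mult_ac)
qed

lemma k_rep_cong:
  assumes "quad_class r q = quad_class r q'"
  shows "quad_class r (k_rep \<alpha> k q) = quad_class r (k_rep \<alpha> k q')"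
proof -
  obtain a b c t where q: "q = ((a, b, c), t)" by (metis prod.collapse)
  with assms obtain m n where q': "q' = ((a, b, c + (wedge b a / real r) *\<^sub>R real_vec m),
    t + of_real (wedge b a / real r * real_of_int n))"
    using quad_class_eqE by blast
  have rt: "row_times k (c + (wedge b a / real r) *\<^sub>R real_vec m)
      = row_times k c + wedge b a / real r * of_int (k$1 * m$1 + k$2 * m$2)"
    by (simp add: row_times_def real_vec_def algebra_simps add_divide_distrib)
  show ?thesis
    unfolding q q' k_rep_def prod.case
    \<comment> \<open>The summand \<open>row_times k c\<close> of \<open>k_dot_t\<close> contributes
      the extra integer, the product of the row \<open>k\<close> with \<open>m\<close>.\<close>
    by (rule quad_class_eqI[where m = m and n = "n + (k$1 * m$1 + k$2 * m$2)"])
      (simp_all only: rt k_dot_c_def k_dot_t_def Let_def of_real_add of_int_add distrib_left, simp_all)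
qed

lemma scaleR_of_real_complex: "x *\<^sub>R complex_of_real y = complex_of_real (x * y)"
  by (simp add: scaleR_conv_of_real)

lemma scale_rep_cong:
  assumes "quad_class r q = quad_class r q'"
  shows "quad_class r (scale_rep s q) = quad_class r (scale_rep s q')"
proof -
  obtain a b c t where q: "q = ((a, b, c), t)" by (metis prod.collapse)
  obtain \<mu> \<rho> where s: "s = (\<mu>, \<rho>)" by (cases s)
  from q assms obtain m n where q': "q' = ((a, b, c + (wedge b a / real r) *\<^sub>R real_vec m),
    t + of_real (wedge b a / real r * real_of_int n))"
    using quad_class_eqE by blast
  show ?thesis
    unfolding q q' s scale_rep_def prod.case
    by (rule quad_class_eqI[where m = m and n = n])
      (simp_all only: wedge_scaleR scaleR_add_right scaleR_of_real_complex, simp_all add: mult_ac)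
qed

section \<open>Composition laws on representatives\<close>

lemma K_rep_one: "K_rep (mat 1) q = q"
proof -
  obtain a b c t where "q = ((a, b, c), t)" by (metis prod.collapse)
  moreover have "row_prods (mat 1) = 0"
    by (simp add: row_prods_def vec_eq_iff forall_2 mat_def)
  ultimately show ?thesis
    by (simp add: K_rep_simp K_dot_c_def)
qed

lemma k_rep_zero: "k_rep \<alpha> 0 q = q"
proof -
  obtain a b c t where "q = ((a, b, c), t)" by (metis prod.collapse)
  then show ?thesis by (simp add: k_rep_def k_dot_c_def k_dot_t_def row_times_def)
qed

lemma scale_rep_one: "scale_rep (1, 1) q = q"
proof -
  obtain a b c t where "q = ((a, b, c), t)" by (metis prod.collapse)
  then show ?thesis by (simp add: scale_rep_def)
qed

lemma scale_rep_scale_rep: "scale_rep (\<mu>, \<rho>) (scale_rep (\<mu>', \<rho>') q) = scale_rep (\<mu> * \<mu>', \<rho> * \<rho>') q"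
proof -
  obtain a b c t where "q = ((a, b, c), t)" by (metis prod.collapse)
  then show ?thesis by (simp add: scale_rep_def mult_ac)
qed

lemma K_rep_scale_rep: "K_rep K (scale_rep s q) = scale_rep s (K_rep K q)"
proof -
  obtain a b c t where q: "q = ((a, b, c), t)" by (metis prod.collapse)
  obtain \<mu> \<rho> where s: "s = (\<mu>, \<rho>)" by (cases s)
  have "half_prod (\<mu> *\<^sub>R a) (\<rho> *\<^sub>R b) = (\<mu> * \<rho>) *\<^sub>R half_prod a b" for a b
    by (simp add: half_prod_def vec_eq_iff)
  then show ?thesis
    unfolding q s
    by (simp add: scale_rep_def K_rep_simp K_dot_c_def wedge_scaleR matrix_vector_mult_scaleR
      scaleR_add_right matrix_vector_mult_diff_distrib scaleR_diff_right)
qed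

lemma k_rep_scale_rep: "k_rep \<alpha> k (scale_rep s q) = scale_rep s (k_rep \<alpha> k q)"
proof -
  obtain a b c t where q: "q = ((a, b, c), t)" by (metis prod.collapse)
  obtain \<mu> \<rho> where s: "s = (\<mu>, \<rho>)" by (cases s)
  have "row_times k (x *\<^sub>R y) = x * row_times k y" for x y
    by (simp add: row_times_def algebra_simps)
  then show ?thesis
    unfolding q s
    by (simp add: scale_rep_def k_rep_def k_dot_c_def k_dot_t_def Let_def scaleR_of_real_complex
      scaleR_add_right scaleR_diff_right of_real_add[symmetric] del: of_real_add)
      (simp add: algebra_simps add_divide_distrib diff_divide_distrib)
qed

text \<open>The two sides differ by the even error of the cocycle identity, multiplied by w/2; this
  is a whole multiple of w.\<close>

lemma K_rep_K_rep:
  assumes "r \<ge> 1" "K \<in> GL2Z" "L \<in> GL2Z"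
  shows "quad_class r (K_rep (K ** L) q) = quad_class r (K_rep K (K_rep L q))"
proof -
  obtain a b c t where q: "q = ((a, b, c), t)" by (metis prod.collapse)
  obtain m where m: "row_prods (K ** L) =
     real_mat K *v row_prods L + of_int (det L) *\<^sub>R row_prods K + 2 *\<^sub>R real_vec m"
    using row_prods_mult by blast
  have \<epsilon>: "real_of_int (det K) * real_of_int (det K) = 1" "real_of_int (det L) * real_of_int (det L) = 1"
    using det_GL2Z(1) assms(2,3) by (metis of_int_1 of_int_mult)+
  have \<epsilon>2: "real_of_int (det K) * (real_of_int (det K) * x) = x"
     "real_of_int (det L) * (real_of_int (det L) * x) = x" for x
    using \<epsilon> by (simp_all flip: mult.assoc)
  have c: "K_dot_c (K ** L) a b c = K_dot_c K (real_mat L *v a) (real_mat L *v b) (K_dot_c L a b c)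
      + wedge b a *\<^sub>R real_vec m"
    by (simp add: K_dot_c_def m wedge_real_mat matrix_vector_mul_assoc real_mat_mult
      matrix_vector_right_distrib matrix_vector_mult_scaleR scaleR_add_right)
  show ?thesis
    unfolding q K_rep_simp c matrix_vector_mul_assoc[symmetric] real_mat_mult
    \<comment> \<open>A multiple of w is r times as many lattice steps, and the step of the pair
      transformed by \<open>K ** L\<close> carries the sign det K det L.\<close>
    by (rule sym, rule quad_class_eqI[where n = 0 and m = "(det K * det L * int r) *s m"])
      (use assms(1) in \<open>simp_all add: real_vec_smult wedge_real_mat \<epsilon> \<epsilon>2 mult_ac\<close>)
qed

text \<open>Moving half of (ka)(kb) into the first term eliminates the separate coordinate products.
  What is left is expressed by ka, kb and \<open>c - half_prod a b\<close>, which behave simply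
  under GL(2,Z), and by a single multiple of w/2.\<close>

lemma k_dot_t_alt:
  assumes "\<alpha> \<noteq> 1"
  shows "k_dot_t \<alpha> k a b c t = t + of_real ((1 + \<alpha>) / (2 * (1 - \<alpha>)) * (row_times k a * row_times k b)
    + row_times k (c - half_prod a b) + of_int (k$1 * k$2) * (wedge b a / 2))"
proof -
  define e where "e = 1 / (1 - \<alpha>)"
  have e: "\<alpha> * e = e - 1" using assms by (simp add: e_def field_simps)
  have 1: "\<alpha> * x * y / (1 - \<alpha>) = (e - 1) * (x * y)" for x y
    by (simp add: e[symmetric]) (simp add: e_def)
  have "(1 + \<alpha>) / (2 * (1 - \<alpha>)) = (1 + \<alpha>) * e / 2" by (simp add: e_def)
  also have "\<dots> = e - 1/2" using e by (simp add: distrib_right)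
  finally have 2: "(1 + \<alpha>) / (2 * (1 - \<alpha>)) = e - 1/2" .
  show ?thesis
    unfolding k_dot_t_def Let_def 1 2 add_left_cancel of_real_eq_iff
    by (simp add: row_times_def half_prod_def wedge_def field_simps)
qed

text \<open>Translations of \<open>c\<close> compose exactly, those of \<open>t\<close> only up to
  the bilinear term -(k1 l2) w, as in a Heisenberg group; this term dies in the classes.\<close>

lemma k_rep_add:
  assumes "\<alpha> > 1" "r \<ge> 1"
  shows "quad_class r (k_rep \<alpha> (k + l) q) = quad_class r (k_rep \<alpha> k (k_rep \<alpha> l q))"
proof -
  obtain a b c t where q: "q = ((a, b, c), t)" by (metis prod.collapse)
  have rt: "row_times (k + l) x = row_times k x + row_times l x" for x
    by (simp add: row_times_def algebra_simps)
  \<comment> \<open>All fractions become polynomial in \<open>e\<close> and are reduced by the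
    single relation \<open>\<alpha> * e = e - 1\<close>.\<close>
  define e where "e = 1 / (1 - \<alpha>)"
  have e: "\<alpha> * e = e - 1" using assms by (simp add: e_def field_simps)
  have e1: "\<alpha> * x * y / (1 - \<alpha>) = (e - 1) * (x * y)" for x y
    by (simp add: e[symmetric]) (simp add: e_def)
  have \<alpha>e: "\<alpha> * (e * x) = e * x - x" for x
    using e by (simp flip: mult.assoc add: left_diff_distrib)
  have e2: "\<alpha> * x / (\<alpha> - 1) = (1 - e) * x" "x / (\<alpha> - 1) = - (e * x)" for x
    using assms(1) by (simp_all add: e_def field_simps)
  have c: "k_dot_c \<alpha> k a b (k_dot_c \<alpha> l a b c) = k_dot_c \<alpha> (k + l) a b c"
    by (simp add: k_dot_c_def rt algebra_simps add_divide_distrib)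
  have t: "k_dot_t \<alpha> k a b (k_dot_c \<alpha> l a b c) (k_dot_t \<alpha> l a b c t) =
      k_dot_t \<alpha> (k + l) a b c t + of_real (wedge b a * of_int (- (k$1 * l$2)))"
    unfolding k_dot_t_def Let_def e1 k_dot_c_def e2
    unfolding of_real_add[symmetric] add.assoc add_left_cancel of_real_eq_iff
    by (simp add: row_times_def wedge_def field_simps \<alpha>e)
  show ?thesis
    unfolding q k_rep_def prod.case c t
    by (rule quad_class_eqI[where m = 0 and n = "int r * (- (k$1 * l$2))"]) (use assms(2) in simp_all)
qed

text \<open>The cocycle identity of \<open>row_prods_mult\<close> for a single row \<open>k\<close>
  in place of the left factor.\<close>

lemma row_prods_form_even:
  "\<exists>z. row_times k (row_prods K) + of_int (k$1 * k$2 * det K)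
     = real_of_int ((k v* K)$1 * (k v* K)$2) + 2 * of_int z"
proof -
  obtain j1 where j1: "k$1 * (k$1 - 1) = 2 * j1" using consecutive_product_even by blast
  obtain j2 where j2: "k$2 * (k$2 - 1) = 2 * j2" using consecutive_product_even by blast
  define z where "z = - (j1 * (K$1$1 * K$1$2) + j2 * (K$2$1 * K$2$2) + k$1 * k$2 * K$1$2 * K$2$1)"
  have "2 * z = - ((2 * j1) * (K$1$1 * K$1$2) + (2 * j2) * (K$2$1 * K$2$2) + 2 * k$1 * k$2 * K$1$2 * K$2$1)"
    by (simp add: z_def)
  then have "k$1 * (K$1$1 * K$1$2) + k$2 * (K$2$1 * K$2$2) + k$1 * k$2 * det K
     = (k v* K)$1 * (k v* K)$2 + 2 * z"
    unfolding j1[symmetric] j2[symmetric]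
    by (simp add: det_2 vector_matrix_mult_def sum_2 algebra_simps)
  from this[THEN arg_cong[where f = real_of_int]] show ?thesis
    by (intro exI[of _ z]) (simp add: row_times_def row_prods_def)
qed

lemma row_times_real_mat: "row_times k (real_mat K *v x) = row_times (k v* K) x"
  by (simp add: row_times_def vec2_simps algebra_simps)

text \<open>This commutation rule is the origin of kK' + k' in the semidirect law. On
  \<open>c\<close> it is exact; on \<open>t\<close>, the row products inside \<open>K_dot_c\<close>
  supply the correction between k1 k2 det K and the product of the entries of kK, up to an even
  number times w/2.\<close>

lemma k_rep_K_rep:
  assumes "\<alpha> > 1" "r \<ge> 1" "K \<in> GL2Z"
  shows "quad_class r (k_rep \<alpha> k (K_rep K q)) = quad_class r (K_rep K (k_rep \<alpha> (k v* K) q))"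
proof -
  obtain a b c t where q: "q = ((a, b, c), t)" by (metis prod.collapse)
  have \<epsilon>: "real_of_int (det K) * real_of_int (det K) = 1"
    using det_GL2Z(1)[OF assms(3)] by (metis of_int_1 of_int_mult)
  have \<epsilon>2: "real_of_int (det K) * (real_of_int (det K) * x) = x" for x
    using \<epsilon> by (simp flip: mult.assoc)
  obtain z where z: "row_times k (row_prods K) + of_int (k$1 * k$2 * det K)
     = real_of_int ((k v* K)$1 * (k v* K)$2) + 2 * of_int z"
    using row_prods_form_even by blast
  define A where "A = real_mat K *v a"
  define B where "B = real_mat K *v b"
  have c: "k_dot_c \<alpha> k A B (K_dot_c K a b c) = K_dot_c K a b (k_dot_c \<alpha> (k v* K) a b c)"
    by (simp add: k_dot_c_def K_dot_c_def A_def B_def row_times_real_mat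
      matrix_vector_mult_diff_distrib matrix_vector_mult_scaleR)
  have rt: "row_times k (K_dot_c K a b c - half_prod A B)
      = row_times (k v* K) (c - half_prod a b) + wedge b a / 2 * row_times k (row_prods K)"
  proof -
    have "row_times k (x + y *\<^sub>R x') = row_times k x + y * row_times k x'" for x y x'
      by (simp add: row_times_def algebra_simps)
    then show ?thesis by (simp add: K_dot_c_def A_def B_def row_times_real_mat)
  qed
  have \<alpha>: "\<alpha> \<noteq> 1" using assms(1) by simp
  have w: "wedge B A = of_int (det K) * wedge b a" by (simp add: A_def B_def wedge_real_mat)
  have rt': "wedge b a / 2 * row_times k (row_prods K) + of_int (k$1 * k$2) * (of_int (det K) * wedge b a / 2)
    = of_int ((k v* K)$1 * (k v* K)$2) * (wedge b a / 2) + wedge b a * of_int z"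
    using arg_cong[OF z, of "\<lambda>x. wedge b a / 2 * x"] by (simp add: algebra_simps)
  have t: "k_dot_t \<alpha> k A B (K_dot_c K a b c) t = k_dot_t \<alpha> (k v* K) a b c t + of_real (wedge b a * of_int z)"
    unfolding k_dot_t_alt[OF \<alpha>] rt w unfolding A_def B_def row_times_real_mat
    unfolding of_real_add[symmetric] add.assoc add_left_cancel of_real_eq_iff
    using rt' by linarith
  show ?thesis
    unfolding q k_rep_def K_rep_simp prod.case A_def[symmetric] B_def[symmetric] c t
    by (rule sym, rule quad_class_eqI[where m = 0 and n = "int r * det K * z"])
      (use assms(2) in \<open>simp_all add: w \<epsilon> \<epsilon>2 mult_ac\<close>)
qed

section \<open>Triviality of translations by d Z^2\<close>

text \<open>In units of w/2, this is what a translation by d m adds to \<open>t\<close> apart from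
  the contribution of \<open>p\<close>. Modulo 2 the hypothesis says that the determinant is odd,
  and the claim becomes a check over residues.\<close>

lemma half_integral_terms_even:
  fixes n11 n12 n21 n22 m1 m2 :: int
  assumes "n11 * n22 - n12 * n21 = 1"
  defines "d \<equiv> n11 + n22 - 2"
  shows "even (d * d * m1 * m2 - d * (m1 * m1 * n12 - m2 * m2 * n21 + m1 * m2 * (n22 - n11))
    - (m1 * ((1 - n22) * (n11 * n12) + n12 * (n21 * n22))
      + m2 * (n21 * (n11 * n12) + (1 - n11) * (n21 * n22))))"
proof -
  have "odd (n11 * n22 - n12 * n21)" using assms(1) by simp
  then show ?thesis unfolding d_def by (auto simp: even_add even_diff even_mult_iff)
qed

lemma k_dot_c_dvd:
  assumes adm: "S_plus_admissible \<alpha>" and ab: "(a, b) \<in> compatible_pairs \<alpha>" and r: "r \<ge> 1"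
    and p: "p_eq \<alpha> r a b c p"
  shows "c_class r a b (k_dot_c \<alpha> (dpar \<alpha> *s m) a b c) = c_class r a b c"
proof -
  define N where "N = N_mat \<alpha> a b"
  have d: "dpar \<alpha> = N$1$1 + N$2$2 - 2" and det: "N$1$1 * N$2$2 - N$1$2 * N$2$1 = 1"
    using det_trace_N_mat[OF adm ab] by (simp_all add: N_def dpar_def det_2)
  \<comment> \<open>The adjugate of I - N applied to (-m2, m1). Since det(I - N) = -d, multiplying
    by I - N gives -d (-m2, m1).\<close>
  define v :: "int^2" where "v = vector [- (1 - N$2$2) * m$2 + N$1$2 * m$1, - N$2$1 * m$2 + (1 - N$1$1) * m$1]"
  have "int r *s vector [- (dpar \<alpha> *s m)$2, (dpar \<alpha> *s m)$1] = (mat 1 - N) *v (- (int r *s v))"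
  proof -
    have "- (dpar \<alpha> * m$2) = - ((1 - N$1$1) * v$1 - N$1$2 * v$2)"
      "dpar \<alpha> * m$1 = - (- N$2$1 * v$1 + (1 - N$2$2) * v$2)"
      unfolding d using det by (simp_all add: v_def vector_2) algebra+
    from this[THEN arg_cong[where f = "\<lambda>x. int r * x"]] show ?thesis
      by (simp add: vec_eq_iff forall_2 matrix_vector_mult_def sum_2 mat_def vector_2 algebra_simps)
  qed
  then have "p_eq \<alpha> r a b (k_dot_c \<alpha> (dpar \<alpha> *s m) a b c) (p + (mat 1 - N) *v (- (int r *s v)))"
    using p_eq_k[OF adm ab r p] by metis
  then have "c_class r a b c = c_class r a b (k_dot_c \<alpha> (dpar \<alpha> *s m) a b c)"
    using c_class_eq_iff_p[OF adm ab r p] unfolding N_def by blast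
  then show ?thesis by simp
qed

text \<open>The product (ka)(kb) is w / (\<alpha> - 1/\<alpha>) times the integral quadratic form k
  ^ kN, because \<open>a\<close> and \<open>b\<close> are eigenvectors. The factor 2d clears the
  irrational coefficient since d = (\<alpha> - 1)^2 / \<alpha>.\<close>

lemma row_times_product_N:
  assumes "S_plus_admissible \<alpha>" "(a, b) \<in> compatible_pairs \<alpha>"
  defines "N \<equiv> N_mat \<alpha> a b"
  shows "(1 + \<alpha>) / (2 * (1 - \<alpha>)) * (row_times k a * row_times k b) * (2 * of_int (dpar \<alpha>)) =
    - (wedge b a * of_int (k$1 * k$1 * N$1$2 - k$2 * k$2 * N$2$1 + k$1 * k$2 * (N$2$2 - N$1$1)))"
proof -
  note \<alpha> = S_plus_admissibleD[OF assms(1)] and ab = compatible_pairsD[OF assms(2), folded N_def]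
  define \<beta> where "\<beta> = inverse \<alpha>"
  have e: "N$1$1 * a$1 + N$1$2 * a$2 = \<alpha> * a$1" "N$2$1 * a$1 + N$2$2 * a$2 = \<alpha> * a$2"
    "N$1$1 * b$1 + N$1$2 * b$2 = \<beta> * b$1" "N$2$1 * b$1 + N$2$2 * b$2 = \<beta> * b$2"
    using ab(2,3) by (auto simp: vec2_simps \<beta>_def)
  have "wedge b a * of_int (k$1 * k$1 * N$1$2 - k$2 * k$2 * N$2$1 + k$1 * k$2 * (N$2$2 - N$1$1))
      = (\<alpha> - \<beta>) * (row_times k a * row_times k b)"
    unfolding wedge_def row_times_def of_int_add of_int_diff of_int_mult using e by algebra
  moreover have "(1 + \<alpha>) / (2 * (1 - \<alpha>)) * (2 * of_int (dpar \<alpha>)) = - (\<alpha> - \<beta>)"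
  proof -
    have d: "of_int (dpar \<alpha>) = \<alpha> + \<beta> - 2" using \<alpha>(2) by (simp add: dpar_def \<beta>_def)
    have "\<alpha> * \<beta> = 1" "1 - \<alpha> \<noteq> 0" using \<alpha>(1) by (simp_all add: \<beta>_def)
    then have "(1 + \<alpha>) * (\<alpha> + \<beta> - 2) = - (\<alpha> - \<beta>) * (1 - \<alpha>)" by algebra
    then show ?thesis unfolding d using \<open>1 - \<alpha> \<noteq> 0\<close> by (simp add: field_simps)
  qed
  ultimately show ?thesis
    by (metis (no_types, lifting) mult.assoc mult.commute mult_minus_left)
qed

text \<open>For \<open>k = d *s m\<close> each of the three terms of \<open>k_dot_t_alt\<close>
  becomes a rational multiple of w: the first by \<open>row_times_product_N\<close>, the second by
  solving the equation for \<open>p\<close> with the adjugate. The multiples of w/2 add up to an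
  even number, and the rest lies in (w/r) Z.\<close>

lemma k_dot_t_dvd:
  assumes adm: "S_plus_admissible \<alpha>" and ab: "(a, b) \<in> compatible_pairs \<alpha>" and r: "r \<ge> 1"
    and p: "p_eq \<alpha> r a b c p"
  shows "t_class r a b (k_dot_t \<alpha> (dpar \<alpha> *s m) a b c t) = t_class r a b t"
proof -
  note \<alpha> = S_plus_admissibleD[OF adm]
  define N where "N = N_mat \<alpha> a b"
  define w where "w = wedge b a"
  define d where "d = dpar \<alpha>"
  have d: "d = N$1$1 + N$2$2 - 2" and det: "N$1$1 * N$2$2 - N$1$2 * N$2$1 = 1"
    using det_trace_N_mat[OF adm ab] by (simp_all add: N_def d_def dpar_def det_2)
  have d0: "d \<noteq> 0" using \<alpha>(3) by (simp add: d_def dpar_def)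
  \<comment> \<open>The form k ^ kN at \<open>m\<close>; at \<open>d *s m\<close> it is d * d times
    as large.\<close>
  define f where "f = m$1 * m$1 * N$1$2 - m$2 * m$2 * N$2$1 + m$1 * m$2 * (N$2$2 - N$1$1)"
  \<comment> \<open>\<open>L\<close> and \<open>P\<close> pair \<open>m\<close> with the adjugate of
    I - N applied to the row products of \<open>N\<close> and to \<open>p\<close>,
    respectively.\<close>
  define L where "L = m$1 * ((1 - N$2$2) * (N$1$1 * N$1$2) + N$1$2 * (N$2$1 * N$2$2))
      + m$2 * (N$2$1 * (N$1$1 * N$1$2) + (1 - N$1$1) * (N$2$1 * N$2$2))"
  define P where "P = m$1 * ((1 - N$2$2) * p$1 + N$1$2 * p$2) + m$2 * (N$2$1 * p$1 + (1 - N$1$1) * p$2)"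
  have "even (d * d * m$1 * m$2 - d * f - L)"
    using half_integral_terms_even[OF det] unfolding d f_def L_def .
  then obtain z where "d * d * m$1 * m$2 - d * f - L = 2 * z" by (rule evenE)
  then have z: "of_int d * of_int d * of_int (m$1) * of_int (m$2) - of_int d * of_int f - of_int L = 2 * real_of_int z"
    by (metis (mono_tags) of_int_diff of_int_mult of_int_numeral)
  have "(1 + \<alpha>) / (2 * (1 - \<alpha>)) * (row_times (d *s m) a * row_times (d *s m) b) * (2 * of_int d)
      = - (w * of_int d * of_int f / 2) * (2 * of_int d)"
  proof -
    have "(d *s m)$1 * (d *s m)$1 * N$1$2 - (d *s m)$2 * (d *s m)$2 * N$2$1
        + (d *s m)$1 * (d *s m)$2 * (N$2$2 - N$1$1) = d * d * f"
      by (simp add: f_def algebra_simps)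
    then show ?thesis
      unfolding row_times_product_N[OF adm ab, folded N_def w_def d_def] by simp
  qed
  then have 1: "(1 + \<alpha>) / (2 * (1 - \<alpha>)) * (row_times (d *s m) a * row_times (d *s m) b)
      = - (w * of_int d * of_int f / 2)"
    using d0 by (simp only: mult_cancel_right) simp
  define x where "x = c - half_prod a b"
  define u where "u = w / real r"
  have E: "(1 - N$1$1) * x$1 - N$1$2 * x$2 = w / 2 * (N$1$1 * N$1$2) + u * p$1"
    "(1 - N$2$2) * x$2 - N$2$1 * x$1 = w / 2 * (N$2$1 * N$2$2) + u * p$2"
    using p[unfolded p_eq_def, folded N_def w_def x_def u_def]
    by (simp_all add: vec2_simps algebra_simps)
  have detr: "real_of_int (N$1$1) * of_int (N$2$2) - of_int (N$1$2) * of_int (N$2$1) = 1"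
    using arg_cong[OF det, of real_of_int] by simp
  have dr: "real_of_int d = of_int (N$1$1) + of_int (N$2$2) - 2" by (simp add: d)
  have 2: "row_times (d *s m) x = - (w / 2 * of_int L) - u * of_int P"
  proof -
    \<comment> \<open>The adjugate times I - N is -d, so d x can be expressed by the coordinates of
      (I - N) x, which \<open>E\<close> provides.\<close>
    have "real_of_int d * x$1 = - ((1 - N$2$2) * ((1 - N$1$1) * x$1 - N$1$2 * x$2)
        + N$1$2 * ((1 - N$2$2) * x$2 - N$2$1 * x$1))"
      "real_of_int d * x$2 = - (N$2$1 * ((1 - N$1$1) * x$1 - N$1$2 * x$2)
        + (1 - N$1$1) * ((1 - N$2$2) * x$2 - N$2$1 * x$1))"
      unfolding dr of_int_diff of_int_1 using detr by algebra+
    then have dx: "real_of_int d * x$1 = - ((1 - N$2$2) * (w / 2 * (N$1$1 * N$1$2) + u * p$1)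
        + N$1$2 * (w / 2 * (N$2$1 * N$2$2) + u * p$2))"
      "real_of_int d * x$2 = - (N$2$1 * (w / 2 * (N$1$1 * N$1$2) + u * p$1)
        + (1 - N$1$1) * (w / 2 * (N$2$1 * N$2$2) + u * p$2))"
      unfolding E by simp_all
    have "row_times (d *s m) x = m$1 * (real_of_int d * x$1) + m$2 * (real_of_int d * x$2)"
      by (simp add: row_times_def)
    then show ?thesis
      unfolding dx L_def P_def by (simp add: field_simps)
  qed
  have sum: "(1 + \<alpha>) / (2 * (1 - \<alpha>)) * (row_times (d *s m) a * row_times (d *s m) b)
    + row_times (d *s m) (c - half_prod a b) + of_int ((d *s m)$1 * (d *s m)$2) * (wedge b a / 2)
    = w / real r * of_int (int r * z - P)"
  proof -
    have eq: "w / real r * of_int (int r * z - P) = w / 2 * (2 * real_of_int z) - u * of_int P"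
      using r by (simp add: u_def right_diff_distrib)
    show ?thesis
      unfolding eq 1 2[unfolded x_def] z[symmetric] w_def[symmetric] by (simp add: field_simps)
  qed
  have "\<alpha> \<noteq> 1" using \<alpha>(1) by simp
  have "k_dot_t \<alpha> (d *s m) a b c t = t + of_real (w / real r * of_int (int r * z - P))"
    unfolding k_dot_t_alt[OF \<open>\<alpha> \<noteq> 1\<close>] sum ..
  then have "t_class r a b t = t_class r a b (k_dot_t \<alpha> (d *s m) a b c t)"
    unfolding t_class_eq_iff w_def by blast
  then show ?thesis by (simp add: d_def)
qed

lemma k_rep_dvd:
  assumes "S_plus_admissible \<alpha>" "r \<ge> 1" "q \<in> A_set \<alpha> r"
  shows "quad_class r (k_rep \<alpha> (dpar \<alpha> *s m) q) = quad_class r q"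
proof -
  obtain a b c t where q: "q = ((a, b, c), t)" by (metis prod.collapse)
  then obtain p where "(a, b) \<in> compatible_pairs \<alpha>" "p_eq \<alpha> r a b c p"
    using assms(3) by (auto simp: in_A_set_iff)
  then show ?thesis
    using k_dot_c_dvd[OF assms(1) _ assms(2)] k_dot_t_dvd[OF assms(1) _ assms(2)]
    by (simp add: q k_rep_def quad_class_eq_iff)
qed

section \<open>Evaluation of the induced actions\<close>

lemma induced_map_eq:
  assumes "y \<in> S" "\<And>y'. y' \<in> S \<Longrightarrow> q y' = q y \<Longrightarrow> f y' = f y"
  shows "induced_map q S f (q y) = f y"
proof -
  have "f ` {y' \<in> S. q y' = q y} = {f y}"
    using assms(1) by (auto dest: assms(2))
  then show ?thesis by (simp add: induced_map_def)
qed

lemma Zd_class_eq_iff: "Zd_class \<alpha> k = Zd_class \<alpha> l \<longleftrightarrow> (\<exists>m. l = k + dpar \<alpha> *s m)"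
proof
  assume "Zd_class \<alpha> k = Zd_class \<alpha> l"
  moreover have "l = l + dpar \<alpha> *s 0" by simp
  ultimately show "\<exists>m. l = k + dpar \<alpha> *s m" unfolding Zd_class_def by blast
next
  assume "\<exists>m. l = k + dpar \<alpha> *s m"
  then obtain m where m: "l = k + dpar \<alpha> *s m" by blast
  have "k + dpar \<alpha> *s n = l + dpar \<alpha> *s (n - m)" "l + dpar \<alpha> *s n = k + dpar \<alpha> *s (n + m)" for n
    by (simp_all add: m vector_add_ldistrib vector_ssub_ldistrib)
  then show "Zd_class \<alpha> k = Zd_class \<alpha> l" unfolding Zd_class_def by blast
qed

lemma on_classes_eq:
  assumes "q \<in> A_set \<alpha> r"
    "\<And>q'. quad_class r q' = quad_class r q \<Longrightarrow> quad_class r (f q') = quad_class r (f q)"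
  shows "on_classes \<alpha> r f (quad_class r q) = quad_class r (f q)"
proof -
  have "induced_map (quad_class r) (A_set \<alpha> r) (quad_class r \<circ> f) (quad_class r q)
      = (quad_class r \<circ> f) q"
    by (rule induced_map_eq[OF assms(1)]) (simp only: o_apply, erule assms(2))
  then show ?thesis by (simp add: on_classes_def)
qed

text \<open>Two induced maps are nested: over representatives of a quadruple class for fixed
  \<open>k\<close>, and over representatives \<open>k\<close> of a residue class. The second is well
  defined by \<open>k_rep_dvd\<close>.\<close>

lemma Zd_act_eq:
  assumes "S_plus_admissible \<alpha>" "r \<ge> 1" "q \<in> A_set \<alpha> r"
  shows "Zd_act \<alpha> r (Zd_class \<alpha> k) (quad_class r q) = quad_class r (k_rep \<alpha> k q)"
proof -
  note \<alpha> = S_plus_admissibleD(1)[OF assms(1)]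
  have eq: "on_classes \<alpha> r (k_rep \<alpha> k) (quad_class r q) = quad_class r (k_rep \<alpha> k q)" for k
    by (rule on_classes_eq[OF assms(3) k_rep_cong])
  have cong: "on_classes \<alpha> r (k_rep \<alpha> l) (quad_class r q) = on_classes \<alpha> r (k_rep \<alpha> k) (quad_class r q)"
    if "Zd_class \<alpha> l = Zd_class \<alpha> k" for l
  proof -
    obtain m where m: "k = l + dpar \<alpha> *s m" using \<open>Zd_class \<alpha> l = _\<close> by (auto simp: Zd_class_eq_iff)
    show ?thesis
      unfolding eq m k_rep_add[OF \<alpha> assms(2)]
      by (rule k_rep_cong) (rule k_rep_dvd[OF assms, symmetric])
  qed
  show ?thesis
    unfolding Zd_act_def eq[symmetric] by (rule induced_map_eq[OF UNIV_I]) (erule cong)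
qed

lemma G_act_eq:
  assumes "S_plus_admissible \<alpha>" "r \<ge> 1" "q \<in> A_set \<alpha> r" "\<mu> \<noteq> 0" "\<rho> \<noteq> 0" "K \<in> GL2Z"
  shows "G_act \<alpha> r ((\<mu>, \<rho>), (K, Zd_class \<alpha> k)) (quad_class r q)
    = quad_class r (K_rep K (k_rep \<alpha> k (scale_rep (\<mu>, \<rho>) q)))"
proof -
  have s: "scale_rep (\<mu>, \<rho>) q \<in> A_set \<alpha> r" using assms scale_rep_in_A_set by blast
  then have k: "k_rep \<alpha> k (scale_rep (\<mu>, \<rho>) q) \<in> A_set \<alpha> r" using assms k_rep_in_A_set by blast
  have "on_classes \<alpha> r (scale_rep (\<mu>, \<rho>)) (quad_class r q) = quad_class r (scale_rep (\<mu>, \<rho>) q)"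
    by (rule on_classes_eq[OF assms(3) scale_rep_cong])
  moreover have "on_classes \<alpha> r (K_rep K) (quad_class r q') = quad_class r (K_rep K q')"
    if "q' \<in> A_set \<alpha> r" for q'
    by (rule on_classes_eq[OF that K_rep_cong[OF assms(6)]])
  ultimately show ?thesis
    by (simp add: G_act_def Zd_act_eq[OF assms(1,2) s] k)
qed

section \<open>Group actions\<close>

text \<open>The library's \<^locale>\<open>group_action\<close> requires extensional maps, which \<^const>\<open>P_act\<close>,
  \<^const>\<open>G_act\<close> and \<^const>\<open>C_act\<close> are not.\<close>

locale acting_group = group G for G (structure) +
  fixes E :: "'b set" and \<phi> :: "'a \<Rightarrow> 'b \<Rightarrow> 'b"
  assumes act_closed: "g \<in> carrier G \<Longrightarrow> x \<in> E \<Longrightarrow> \<phi> g x \<in> E"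
    and act_one: "x \<in> E \<Longrightarrow> \<phi> \<one> x = x"
    and act_mult: "g \<in> carrier G \<Longrightarrow> h \<in> carrier G \<Longrightarrow> x \<in> E \<Longrightarrow> \<phi> (g \<otimes> h) x = \<phi> g (\<phi> h x)"
begin

lemma act_inv: "g \<in> carrier G \<Longrightarrow> x \<in> E \<Longrightarrow> \<phi> (inv g) (\<phi> g x) = x"
  by (metis act_mult act_one inv_closed l_inv)

lemma orbit_act:
  assumes "g \<in> carrier G" "x \<in> E"
  shows "orbit G \<phi> (\<phi> g x) = orbit G \<phi> x"
proof
  show "orbit G \<phi> (\<phi> g x) \<subseteq> orbit G \<phi> x"
    using assms by (auto simp: orbit_def simp flip: act_mult)
  show "orbit G \<phi> x \<subseteq> orbit G \<phi> (\<phi> g x)"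
  proof
    fix y assume "y \<in> orbit G \<phi> x"
    then obtain h where h: "h \<in> carrier G" "y = \<phi> h x" by (auto simp: orbit_def)
    have "y = \<phi> (h \<otimes> inv g) (\<phi> g x)"
      unfolding h(2) using assms h(1) by (simp add: act_mult act_closed act_inv)
    moreover have "h \<otimes> inv g \<in> carrier G" using assms h by simp
    ultimately show "y \<in> orbit G \<phi> (\<phi> g x)" unfolding orbit_def by blast
  qed
qed

lemma orbit_eq_iff:
  assumes "x \<in> E" "y \<in> E"
  shows "orbit G \<phi> x = orbit G \<phi> y \<longleftrightarrow> (\<exists>g\<in>carrier G. \<phi> g x = y)"
proof
  assume "orbit G \<phi> x = orbit G \<phi> y"
  moreover have "\<phi> \<one> y \<in> orbit G \<phi> y" unfolding orbit_def by blast
  ultimately have "y \<in> orbit G \<phi> x" using assms by (simp add: act_one)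
  then show "\<exists>g\<in>carrier G. \<phi> g x = y" by (auto simp: orbit_def)
next
  assume "\<exists>g\<in>carrier G. \<phi> g x = y"
  then show "orbit G \<phi> x = orbit G \<phi> y" using orbit_act assms(1) by metis
qed

lemma stabilizer_subgroup:
  assumes "x \<in> E"
  shows "subgroup (stabilizer G \<phi> x) G"
  using assms act_inv by unfold_locales (auto simp: stabilizer_def act_one act_mult, metis)

text \<open>The inverse group element supplies the inverse bijection. This leads back to the library
  notion for \<open>ZN_act\<close>.\<close>

lemma group_action_if_extensional:
  assumes "\<And>g. g \<in> carrier G \<Longrightarrow> \<phi> g \<in> extensional E"
  shows "group_action G E \<phi>"
proof -
  have bij: "\<phi> g \<in> Bij E" if g: "g \<in> carrier G" for g
  proof -
    have "bij_betw (\<phi> g) E E"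
      using g act_closed act_inv[OF g] act_inv[OF inv_closed[OF g]]
      by (intro bij_betwI[where g = "\<phi> (inv g)"]) auto
    then show ?thesis using assms g by (simp add: Bij_def)
  qed
  have "\<phi> (g \<otimes> h) = compose E (\<phi> g) (\<phi> h)" if "g \<in> carrier G" "h \<in> carrier G" for g h
    using assms that by (intro extensionalityI[of _ E]) (auto simp: compose_def act_mult)
  then show ?thesis
    using bij unfolding group_action_def group_hom_def group_hom_axioms_def
    by (intro conjI is_group group_BijGroup) (auto simp: hom_def BijGroup_def)
qed

end

text \<open>Two maps on \<open>C\<close> with the same fibres have canonically identified images.
  Both bijections of the theorem are instances, with the orbit of the class of \<open>c\<close> as
  \<open>f\<close>.\<close>

lemma bij_betw_quotients:
  assumes "\<And>c c'. c \<in> C \<Longrightarrow> c' \<in> C \<Longrightarrow> f c = f c' \<longleftrightarrow> h c = h c'"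
  shows "\<exists>F. bij_betw F (f ` C) (h ` C) \<and> (\<forall>c\<in>C. F (f c) = h c)"
proof -
  have F: "h (inv_into C f (f c)) = h c" if "c \<in> C" for c
    using assms that by (metis f_inv_into_f imageI inv_into_into)
  moreover have "inj_on (\<lambda>x. h (inv_into C f x)) (f ` C)"
    using F assms by (intro inj_onI) auto
  moreover have "(\<lambda>x. h (inv_into C f x)) ` (f ` C) = h ` C"
    using F by (simp add: image_image)
  ultimately show ?thesis
    by (intro exI[of _ "\<lambda>x. h (inv_into C f x)"]) (simp add: bij_betw_def)
qed

section \<open>The group G and its actions on pairs and classes\<close>

lemma group_pos_reals: "group pos_reals"
  by (rule groupI)
    (auto simp: pos_reals_def, metis left_inverse less_irrefl positive_imp_inverse_positive)

lemma group_nonzero_reals: "group nonzero_reals"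
  by (rule groupI) (auto simp: nonzero_reals_def, metis left_inverse nonzero_imp_inverse_nonzero)

lemma semidirect_mult:
  "(K, Zd_class \<alpha> k) \<otimes>\<^bsub>semidirect \<alpha>\<^esub> (K', Zd_class \<alpha> k') = (K ** K', Zd_class \<alpha> (k v* K' + k'))"
proof -
  have "{x v* K' + y | x y. x \<in> Zd_class \<alpha> k \<and> y \<in> Zd_class \<alpha> k'} = Zd_class \<alpha> (k v* K' + k')"
  proof safe
    fix x y assume "x \<in> Zd_class \<alpha> k" "y \<in> Zd_class \<alpha> k'"
    then obtain m n where "x = k + dpar \<alpha> *s m" "y = k' + dpar \<alpha> *s n" by (auto simp: Zd_class_def)
    then have "x v* K' + y = k v* K' + k' + dpar \<alpha> *s (m v* K' + n)"
      by (simp add: vec_eq_iff vector_matrix_mult_def sum_2 algebra_simps)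
    then show "x v* K' + y \<in> Zd_class \<alpha> (k v* K' + k')" unfolding Zd_class_def by blast
  next
    fix x assume "x \<in> Zd_class \<alpha> (k v* K' + k')"
    then obtain m where "x = k v* K' + (k' + dpar \<alpha> *s m)" by (auto simp: Zd_class_def add.assoc)
    moreover have "k' + dpar \<alpha> *s m \<in> Zd_class \<alpha> k'" unfolding Zd_class_def by blast
    moreover have "k \<in> Zd_class \<alpha> k" unfolding Zd_class_def by (auto intro: exI[of _ 0])
    ultimately show "\<exists>l y. x = l v* K' + y \<and> l \<in> Zd_class \<alpha> k \<and> y \<in> Zd_class \<alpha> k'" by blast
  qed
  then show ?thesis by (simp add: semidirect_def)
qed

lemma group_semidirect: "group (semidirect \<alpha>)"
proof (rule groupI)
  have vm: "(k v* K) v* L = k v* (K ** L)" for k :: "int^2" and K L :: "int^2^2"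
    by (simp add: vec_eq_iff forall_2 vector_matrix_mult_def matrix_matrix_mult_def sum_2 algebra_simps)
  have va: "(k + l) v* L = k v* L + l v* L" for k l :: "int^2" and L :: "int^2^2"
    by (simp add: vec_eq_iff forall_2 vector_matrix_mult_def sum_2 algebra_simps)
  have v1: "k v* mat 1 = k" and v0: "0 v* K = 0" and vn: "(- k) v* K = - (k v* K)"
    for k :: "int^2" and K :: "int^2^2"
    by (simp_all add: vec_eq_iff forall_2 vector_matrix_mult_def mat_def sum_2)
  let ?G = "semidirect \<alpha>"
  have carr: "x \<in> carrier ?G \<longleftrightarrow> (\<exists>K k. K \<in> GL2Z \<and> x = (K, Zd_class \<alpha> k))" for x
    by (auto simp: semidirect_def)
  have one: "\<one>\<^bsub>?G\<^esub> = (mat 1, Zd_class \<alpha> 0)" by (simp add: semidirect_def)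
  show "\<one>\<^bsub>?G\<^esub> \<in> carrier ?G" using one_GL2Z by (auto simp: carr one)
  fix x assume "x \<in> carrier ?G"
  then obtain K k where x: "K \<in> GL2Z" "x = (K, Zd_class \<alpha> k)" by (auto simp: carr)
  show "\<one>\<^bsub>?G\<^esub> \<otimes>\<^bsub>?G\<^esub> x = x" by (simp add: x one semidirect_mult v0)
  show "\<exists>y\<in>carrier ?G. y \<otimes>\<^bsub>?G\<^esub> x = \<one>\<^bsub>?G\<^esub>"
  proof -
    obtain K' where K': "K' \<in> GL2Z" "K' ** K = mat 1" using GL2Z_inverse[OF x(1)] by blast
    then have "(K', Zd_class \<alpha> (- (k v* K'))) \<otimes>\<^bsub>?G\<^esub> x = \<one>\<^bsub>?G\<^esub>"
      by (simp add: x(2) one semidirect_mult vn vm v1)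
    then show ?thesis using K'(1) carr by blast
  qed
  fix y assume "y \<in> carrier ?G"
  then obtain L l where y: "L \<in> GL2Z" "y = (L, Zd_class \<alpha> l)" by (auto simp: carr)
  show "x \<otimes>\<^bsub>?G\<^esub> y \<in> carrier ?G"
    using GL2Z_mult x(1) y(1) by (auto simp: carr x(2) y(2) semidirect_mult)
  fix z assume "z \<in> carrier ?G"
  then obtain M m where z: "z = (M, Zd_class \<alpha> m)" by (auto simp: carr)
  show "x \<otimes>\<^bsub>?G\<^esub> y \<otimes>\<^bsub>?G\<^esub> z = x \<otimes>\<^bsub>?G\<^esub> (y \<otimes>\<^bsub>?G\<^esub> z)"
    by (simp add: x(2) y(2) z semidirect_mult vm va matrix_mul_assoc add.assoc)
qed

lemma group_G_grp: "group (G_grp \<alpha>)"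
  unfolding G_grp_def
  by (intro DirProd_group group_pos_reals group_nonzero_reals group_semidirect)

lemma G_grp_carrier_iff:
  "((\<mu>, \<rho>), (K, Zd_class \<alpha> k)) \<in> carrier (G_grp \<alpha>) \<longleftrightarrow> \<mu> > 0 \<and> \<rho> \<noteq> 0 \<and> K \<in> GL2Z"
  by (auto simp: G_grp_def pos_reals_def nonzero_reals_def semidirect_def DirProd_def)

lemma G_grp_carrierE:
  assumes "g \<in> carrier (G_grp \<alpha>)"
  obtains \<mu> \<rho> K k where "g = ((\<mu>, \<rho>), (K, Zd_class \<alpha> k))" "\<mu> > 0" "\<rho> \<noteq> 0" "K \<in> GL2Z"
  using assms by (auto simp: G_grp_def pos_reals_def nonzero_reals_def semidirect_def DirProd_def)

lemma G_grp_mult: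
  "((\<mu>, \<rho>), (K, Zd_class \<alpha> k)) \<otimes>\<^bsub>G_grp \<alpha>\<^esub> ((\<mu>', \<rho>'), (K', Zd_class \<alpha> k'))
    = ((\<mu> * \<mu>', \<rho> * \<rho>'), (K ** K', Zd_class \<alpha> (k v* K' + k')))"
  unfolding semidirect_mult[symmetric]
  by (simp add: G_grp_def DirProd_def pos_reals_def nonzero_reals_def)

lemma G_grp_one: "\<one>\<^bsub>G_grp \<alpha>\<^esub> = ((1, 1), (mat 1, Zd_class \<alpha> 0))"
  by (simp add: G_grp_def DirProd_def pos_reals_def nonzero_reals_def semidirect_def)

lemma P_act_simp: "P_act ((\<mu>, \<rho>), (K, \<kappa>)) (a, b) = (\<mu> *\<^sub>R (real_mat K *v a), \<rho> *\<^sub>R (real_mat K *v b))"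
  by (simp add: P_act_def)

lemma acting_group_P: "acting_group (G_grp \<alpha>) (compatible_pairs \<alpha>) P_act"
proof (intro acting_group.intro acting_group_axioms.intro group_G_grp)
  fix g x assume g: "g \<in> carrier (G_grp \<alpha>)" and x: "x \<in> compatible_pairs \<alpha>"
  from g obtain \<mu> \<rho> K k where g': "g = ((\<mu>, \<rho>), (K, Zd_class \<alpha> k))" "\<mu> > 0" "\<rho> \<noteq> 0" "K \<in> GL2Z"
    by (rule G_grp_carrierE)
  obtain a b where x': "x = (a, b)" by (cases x)
  obtain K' where "K ** K' = mat 1" "K' ** K = mat 1" using GL2Z_inverse[OF g'(4)] .
  then show "P_act g x \<in> compatible_pairs \<alpha>"
    using compatible_pairs_transform(1)[of a b \<alpha> K K' \<mu> \<rho>] g' x by (simp add: x' P_act_simp)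
next
  fix x :: "(real^2) \<times> (real^2)"
  show "P_act \<one>\<^bsub>G_grp \<alpha>\<^esub> x = x" by (cases x) (simp add: G_grp_one P_act_simp)
next
  fix g h and x :: "(real^2) \<times> (real^2)" assume "g \<in> carrier (G_grp \<alpha>)" "h \<in> carrier (G_grp \<alpha>)"
  then show "P_act (g \<otimes>\<^bsub>G_grp \<alpha>\<^esub> h) x = P_act g (P_act h x)"
    by (elim G_grp_carrierE, cases x)
      (simp add: G_grp_mult P_act_simp real_mat_mult matrix_vector_mult_scaleR matrix_vector_mul_assoc)
qed

text \<open>A product of two elements is sorted into scaling, translation and matrix: scalings
  commute with the other moves already on representatives, and pulling the inner \<open>K'\<close>
  past the outer \<open>k\<close> turns \<open>k\<close> into kK'.\<close>

lemma acting_group_G: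
  assumes "S_plus_admissible \<alpha>" "r \<ge> 1"
  shows "acting_group (G_grp \<alpha>) (AA_set \<alpha> r) (G_act \<alpha> r)"
proof (intro acting_group.intro acting_group_axioms.intro group_G_grp)
  note \<alpha> = S_plus_admissibleD(1)[OF assms(1)]
  fix x assume "x \<in> AA_set \<alpha> r"
  then obtain q where q: "q \<in> A_set \<alpha> r" "x = quad_class r q" by (auto simp: AA_set_def)
  show "G_act \<alpha> r \<one>\<^bsub>G_grp \<alpha>\<^esub> x = x"
    unfolding q(2) G_grp_one using one_GL2Z
    by (simp add: G_act_eq[OF assms q(1)] K_rep_one k_rep_zero scale_rep_one)
  fix h assume "h \<in> carrier (G_grp \<alpha>)"
  then obtain \<mu>' \<rho>' K' k' where h: "h = ((\<mu>', \<rho>'), (K', Zd_class \<alpha> k'))" "\<mu>' > 0" "\<rho>' \<noteq> 0" "K' \<in> GL2Z"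
    by (rule G_grp_carrierE)
  let ?q = "K_rep K' (k_rep \<alpha> k' (scale_rep (\<mu>', \<rho>') q))"
  have q': "?q \<in> A_set \<alpha> r"
    using assms h q(1) by (intro K_rep_in_A_set k_rep_in_A_set scale_rep_in_A_set) auto
  have hx: "G_act \<alpha> r h x = quad_class r ?q"
    unfolding h(1) q(2) using h by (intro G_act_eq[OF assms q(1)]) auto
  then show "G_act \<alpha> r h x \<in> AA_set \<alpha> r"
    using q' by (simp add: AA_set_def)
  fix g assume "g \<in> carrier (G_grp \<alpha>)"
  then obtain \<mu> \<rho> K k where g: "g = ((\<mu>, \<rho>), (K, Zd_class \<alpha> k))" "\<mu> > 0" "\<rho> \<noteq> 0" "K \<in> GL2Z"
    by (rule G_grp_carrierE)
  define s where "s = scale_rep (\<mu> * \<mu>', \<rho> * \<rho>') q"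
  have "G_act \<alpha> r g (G_act \<alpha> r h x) = quad_class r (K_rep K (k_rep \<alpha> k (scale_rep (\<mu>, \<rho>) ?q)))"
    unfolding hx g(1) using g by (intro G_act_eq[OF assms q']) auto
  also have "scale_rep (\<mu>, \<rho>) ?q = K_rep K' (k_rep \<alpha> k' s)"
    by (simp add: s_def flip: K_rep_scale_rep k_rep_scale_rep scale_rep_scale_rep)
  also have "quad_class r (K_rep K (k_rep \<alpha> k (K_rep K' (k_rep \<alpha> k' s))))
      = quad_class r (K_rep K (K_rep K' (k_rep \<alpha> (k v* K') (k_rep \<alpha> k' s))))"
    by (rule K_rep_cong[OF g(4) k_rep_K_rep[OF \<alpha> assms(2) h(4)]])
  also have "\<dots> = quad_class r (K_rep (K ** K') (k_rep \<alpha> (k v* K') (k_rep \<alpha> k' s)))"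
    by (rule K_rep_K_rep[OF assms(2) g(4) h(4), symmetric])
  also have "\<dots> = quad_class r (K_rep (K ** K') (k_rep \<alpha> (k v* K' + k') s))"
    by (rule K_rep_cong[OF GL2Z_mult[OF g(4) h(4)] k_rep_add[OF \<alpha> assms(2), symmetric]])
  also have "\<dots> = G_act \<alpha> r (g \<otimes>\<^bsub>G_grp \<alpha>\<^esub> h) x"
    unfolding g(1) h(1) G_grp_mult q(2) s_def using g h GL2Z_mult
    by (intro G_act_eq[OF assms q(1), symmetric]) auto
  finally show "G_act \<alpha> r (g \<otimes>\<^bsub>G_grp \<alpha>\<^esub> h) x = G_act \<alpha> r g (G_act \<alpha> r h x)" by simp
qed

text \<open>If x and y are eigenvectors of N for e, then x ^ y = e^2 (x ^ y) because det N = 1, so x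
  ^ y = 0 unless e^2 = 1. The factors are only known to be nonzero; the sign of the first has to be
  settled wherever the lemma is applied.\<close>

lemma compatible_pairs_same_N:
  assumes "S_plus_admissible \<alpha>" "(a, b) \<in> compatible_pairs \<alpha>" "(a', b') \<in> compatible_pairs \<alpha>"
    "N_mat \<alpha> a b = N_mat \<alpha> a' b'"
  shows "\<exists>\<mu> \<rho>. \<mu> \<noteq> 0 \<and> \<rho> \<noteq> 0 \<and> a' = \<mu> *\<^sub>R a \<and> b' = \<rho> *\<^sub>R b"
proof -
  note \<alpha> = S_plus_admissibleD(1)[OF assms(1)]
  have eig: "\<exists>k. k \<noteq> 0 \<and> y = k *\<^sub>R x"
    if ev: "real_mat (N_mat \<alpha> a b) *v x = e *s x" "real_mat (N_mat \<alpha> a b) *v y = e *s y"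
      "x \<noteq> 0" "y \<noteq> 0" "e * e \<noteq> 1" for x y e
  proof -
    have "wedge x y = (e * e) * wedge x y"
      using wedge_real_mat[of "N_mat \<alpha> a b" x y] det_trace_N_mat(1)[OF assms(1,2)]
      by (simp add: ev(1,2) scalar_mult_eq_scaleR wedge_scaleR)
    then have "(e * e - 1) * wedge x y = 0" by (simp add: algebra_simps)
    then have "wedge x y = 0" using ev(5) by simp
    then obtain k where "y = k *\<^sub>R x" using wedge_eq_0_iff[OF ev(3)] by auto
    then show ?thesis using ev(4) by auto
  qed
  have nz: "a \<noteq> 0" "b \<noteq> 0" "a' \<noteq> 0" "b' \<noteq> 0"
    using compatible_pairsD(1)[OF assms(2)] compatible_pairsD(1)[OF assms(3)] by (auto simp: wedge_def)
  have "\<alpha> * \<alpha> > 1" using \<alpha> by (simp add: less_1_mult)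
  then have ne: "\<alpha> * \<alpha> \<noteq> 1" "inverse \<alpha> * inverse \<alpha> \<noteq> 1"
    by (auto simp flip: inverse_mult_distrib)
  show ?thesis
    using eig[of a \<alpha> a'] eig[of b "inverse \<alpha>" b'] nz ne
      compatible_pairsD(2,3)[OF assms(2)] compatible_pairsD(2,3)[OF assms(3), folded assms(4)] by metis
qed

definition base :: "quad_class \<Rightarrow> (real^2) \<times> (real^2)" where
  "base = (\<lambda>(a, b, C, T). (a, b))"

lemma base_quad_class [simp]: "base (quad_class r ((a, b, c), t)) = (a, b)"
  and third_quad_class [simp]: "third (quad_class r ((a, b, c), t)) = c_class r a b c"
  by (simp_all add: base_def third_def quad_class_def)

lemma AA_setE:
  assumes "x \<in> AA_set \<alpha> r"
  obtains a b c t where "x = quad_class r ((a, b, c), t)" "(a, b) \<in> compatible_pairs \<alpha>" "c \<in> C_set \<alpha> r a b"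
  using assms by (auto simp: AA_set_def A_set_def T_set_def)

lemma quad_class_in_AA_set:
  "(a, b) \<in> compatible_pairs \<alpha> \<Longrightarrow> c \<in> C_set \<alpha> r a b \<Longrightarrow> quad_class r ((a, b, c), t) \<in> AA_set \<alpha> r"
  by (auto simp: AA_set_def A_set_def T_set_def)

lemma base_third_eqE:
  assumes "x \<in> AA_set \<alpha> r" "base x = (a, b)" "third x = c_class r a b c"
  obtains t where "x = quad_class r ((a, b, c), t)"
proof -
  obtain a' b' c' t where x: "x = quad_class r ((a', b', c'), t)" using assms(1) by (rule AA_setE)
  with assms have "x = quad_class r ((a, b, c), t)"
    by (simp add: quad_class_eq_iff)
  then show ?thesis by (rule that)
qed

lemma base_G_act:
  assumes "S_plus_admissible \<alpha>" "r \<ge> 1" "g \<in> carrier (G_grp \<alpha>)" "x \<in> AA_set \<alpha> r"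
  shows "base (G_act \<alpha> r g x) = P_act g (base x)"
proof -
  obtain \<mu> \<rho> K k where g: "g = ((\<mu>, \<rho>), (K, Zd_class \<alpha> k))" "\<mu> > 0" "\<rho> \<noteq> 0" "K \<in> GL2Z"
    using assms(3) by (rule G_grp_carrierE)
  obtain a b c t where x: "x = quad_class r ((a, b, c), t)" "(a, b) \<in> compatible_pairs \<alpha>" "c \<in> C_set \<alpha> r a b"
    using assms(4) by (rule AA_setE)
  then have "((a, b, c), t) \<in> A_set \<alpha> r" by (simp add: A_set_def T_set_def)
  then show ?thesis
    unfolding g(1) x(1) using g(2-)
    by (subst G_act_eq[OF assms(1,2)])
      (simp_all add: scale_rep_def k_rep_def K_rep_simp P_act_simp matrix_vector_mult_scaleR)
qed

text \<open>The coordinate \<open>t\<close> never influences the others; this makes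
  \<open>C_act\<close> well defined.\<close>

lemma third_G_act:
  assumes "S_plus_admissible \<alpha>" "r \<ge> 1" "g \<in> carrier (G_grp \<alpha>)" "x \<in> AA_set \<alpha> r" "y \<in> AA_set \<alpha> r"
    "base x = base y" "third x = third y"
  shows "third (G_act \<alpha> r g x) = third (G_act \<alpha> r g y)"
proof -
  obtain \<mu> \<rho> K k where g: "g = ((\<mu>, \<rho>), (K, Zd_class \<alpha> k))" "\<mu> > 0" "\<rho> \<noteq> 0" "K \<in> GL2Z"
    using assms(3) by (rule G_grp_carrierE)
  obtain a b c t where x: "x = quad_class r ((a, b, c), t)" "(a, b) \<in> compatible_pairs \<alpha>" "c \<in> C_set \<alpha> r a b"
    using assms(4) by (rule AA_setE)
  obtain t' where y: "y = quad_class r ((a, b, c), t')"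
    using base_third_eqE[OF assms(5), of a b c] assms(6,7) by (auto simp: x(1))
  have "((a, b, c), t) \<in> A_set \<alpha> r" for t using x by (simp add: A_set_def T_set_def)
  then show ?thesis
    unfolding g(1) x(1) y using g(2-)
    by (simp add: G_act_eq[OF assms(1,2)] scale_rep_def k_rep_def K_rep_simp)
qed

section \<open>The stabiliser acting on classes of \<open>c\<close>, the centraliser on
  residues\<close>

locale compatible_pair =
  fixes \<alpha> :: real and a b :: "real^2" and r :: nat
  assumes adm: "S_plus_admissible \<alpha>" and ab: "(a, b) \<in> compatible_pairs \<alpha>" and r: "r \<ge> 1"
begin

abbreviation "N \<equiv> N_mat \<alpha> a b"
abbreviation "Stab \<equiv> stab_grp \<alpha> a b"
abbreviation "Z \<equiv> pos_centraliser N a"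
abbreviation "C \<equiv> C_set \<alpha> r a b"
abbreviation "cls \<equiv> c_class r a b"

interpretation GP: acting_group "G_grp \<alpha>" "compatible_pairs \<alpha>" P_act
  by (rule acting_group_P)

interpretation GA: acting_group "G_grp \<alpha>" "AA_set \<alpha> r" "G_act \<alpha> r"
  by (rule acting_group_G[OF adm r])

lemma carrier_Stab_iff: "g \<in> carrier Stab \<longleftrightarrow> g \<in> carrier (G_grp \<alpha>) \<and> P_act g (a, b) = (a, b)"
  by (simp add: stab_grp_def stabilizer_def)

lemma group_Stab: "group Stab"
  unfolding stab_grp_def
  by (rule subgroup.subgroup_is_group[OF GP.stabilizer_subgroup[OF ab] group_G_grp])

lemma third_in_C_quot: "x \<in> AA_set \<alpha> r \<Longrightarrow> base x = (a, b) \<Longrightarrow> third x \<in> C_quot \<alpha> r a b"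
  by (elim AA_setE) (auto simp: C_quot_def)

lemma C_act_third:
  assumes "g \<in> carrier Stab" "x \<in> AA_set \<alpha> r" "base x = (a, b)"
  shows "C_act \<alpha> r a b g (third x) = third (G_act \<alpha> r g x)"
proof -
  have S: "{(a', b', C, T) \<in> AA_set \<alpha> r. a' = a \<and> b' = b} = {x \<in> AA_set \<alpha> r. base x = (a, b)}"
    by (auto simp: base_def)
  have "induced_map third {x \<in> AA_set \<alpha> r. base x = (a, b)} (third \<circ> G_act \<alpha> r g) (third x)
      = (third \<circ> G_act \<alpha> r g) x"
  proof (rule induced_map_eq)
    fix y assume "y \<in> {x \<in> AA_set \<alpha> r. base x = (a, b)}" "third y = third x"
    then show "(third \<circ> G_act \<alpha> r g) y = (third \<circ> G_act \<alpha> r g) x"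
      using third_G_act[OF adm r, of g y x] assms by (simp add: carrier_Stab_iff)
  qed (use assms in simp)
  then show ?thesis by (simp add: C_act_def S)
qed

lemma acting_group_C: "acting_group Stab (C_quot \<alpha> r a b) (C_act \<alpha> r a b)"
proof (intro acting_group.intro acting_group_axioms.intro group_Stab)
  fix X assume "X \<in> C_quot \<alpha> r a b"
  then obtain c where "c \<in> C" "X = cls c" by (auto simp: C_quot_def)
  then have "\<exists>x \<in> AA_set \<alpha> r. base x = (a, b) \<and> third x = X"
    \<comment> \<open>The value 0 for \<open>t\<close> is an arbitrary lift.\<close>
    using quad_class_in_AA_set[OF ab, of c r 0] by (intro bexI[of _ "quad_class r ((a, b, c), 0)"]) auto
  then obtain x where x: "x \<in> AA_set \<alpha> r" "base x = (a, b)" "X = third x" by blast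
  have "\<one>\<^bsub>Stab\<^esub> \<in> carrier Stab" by (simp add: group.is_monoid[OF group_Stab] monoid.one_closed)
  then show "C_act \<alpha> r a b \<one>\<^bsub>Stab\<^esub> X = X"
    using x GA.act_one[OF x(1)] by (simp add: C_act_third stab_grp_def)
  fix h assume h: "h \<in> carrier Stab"
  then have hx: "G_act \<alpha> r h x \<in> AA_set \<alpha> r" "base (G_act \<alpha> r h x) = (a, b)"
    using x base_G_act[OF adm r _ x(1)] GA.act_closed by (auto simp: carrier_Stab_iff)
  show "C_act \<alpha> r a b h X \<in> C_quot \<alpha> r a b"
    using C_act_third[OF h x(1,2)] third_in_C_quot[OF hx] x(3) by simp
  fix g assume g: "g \<in> carrier Stab"
  have gh: "g \<otimes>\<^bsub>Stab\<^esub> h \<in> carrier Stab"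
    using g h group_Stab by (simp add: group.is_monoid monoid.m_closed)
  have "G_act \<alpha> r (g \<otimes>\<^bsub>Stab\<^esub> h) x = G_act \<alpha> r g (G_act \<alpha> r h x)"
    using g h x(1) by (simp add: stab_grp_def[of \<alpha> a b] carrier_Stab_iff[unfolded stab_grp_def] GA.act_mult stabilizer_def)
  then show "C_act \<alpha> r a b (g \<otimes>\<^bsub>Stab\<^esub> h) X = C_act \<alpha> r a b g (C_act \<alpha> r a b h X)"
    using C_act_third[OF gh x(1,2)] C_act_third[OF g hx] C_act_third[OF h x(1,2)] x(3) by simp
qed

lemma group_Z: "group Z"
proof (rule groupI)
  have carr: "K \<in> carrier Z \<longleftrightarrow> K \<in> GL2Z \<and> K ** N = N ** K \<and> (\<exists>s>0. real_mat K *v a = s *\<^sub>R a)" for K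
    by (simp add: pos_centraliser_def)
  have mult: "K \<otimes>\<^bsub>Z\<^esub> L = K ** L" and one: "\<one>\<^bsub>Z\<^esub> = mat 1" for K L
    by (simp_all add: pos_centraliser_def)
  show "\<one>\<^bsub>Z\<^esub> \<in> carrier Z"
    unfolding carr one using one_GL2Z by (auto intro: exI[of _ 1])
  fix K assume K: "K \<in> carrier Z"
  then obtain s where s: "s > 0" "real_mat K *v a = s *\<^sub>R a" and KN: "K ** N = N ** K" and "K \<in> GL2Z"
    by (auto simp: carr)
  then obtain K' where K': "K' \<in> GL2Z" "K ** K' = mat 1" "K' ** K = mat 1"
    using GL2Z_inverse by blast
  show "\<one>\<^bsub>Z\<^esub> \<otimes>\<^bsub>Z\<^esub> K = K" by (simp add: mult one)
  have "K' ** N = K' ** (N ** K) ** K'"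
    by (simp add: K' flip: matrix_mul_assoc)
  also have "\<dots> = N ** K'"
    by (simp add: K' matrix_mul_assoc flip: KN)
  finally have "K' ** N = N ** K'" .
  moreover have "real_mat K' *v a = inverse s *\<^sub>R a"
  proof -
    have "a = real_mat (K' ** K) *v a" by (simp add: K')
    also have "\<dots> = s *\<^sub>R (real_mat K' *v a)"
      by (simp add: real_mat_mult s matrix_vector_mult_scaleR flip: matrix_vector_mul_assoc)
    finally have "inverse s *\<^sub>R a = inverse s *\<^sub>R s *\<^sub>R (real_mat K' *v a)" by simp
    then show ?thesis using s(1) by simp
  qed
  ultimately have "K' \<in> carrier Z"
    unfolding carr using K'(1) s(1) positive_imp_inverse_positive by blast
  then show "\<exists>L\<in>carrier Z. L \<otimes>\<^bsub>Z\<^esub> K = \<one>\<^bsub>Z\<^esub>"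
    by (intro bexI[of _ K']) (simp_all add: mult one K')
  fix L assume L: "L \<in> carrier Z"
  then obtain s' where s': "s' > 0" "real_mat L *v a = s' *\<^sub>R a" and LN: "L ** N = N ** L" and "L \<in> GL2Z"
    by (auto simp: carr)
  have "real_mat (K ** L) *v a = (s' * s) *\<^sub>R a"
    by (simp add: real_mat_mult s s' matrix_vector_mult_scaleR flip: matrix_vector_mul_assoc)
  moreover have "K ** L ** N = N ** (K ** L)"
    by (metis KN LN matrix_mul_assoc)
  ultimately show "K \<otimes>\<^bsub>Z\<^esub> L \<in> carrier Z"
    unfolding carr mult using GL2Z_mult \<open>K \<in> GL2Z\<close> \<open>L \<in> GL2Z\<close> s(1) s'(1) mult_pos_pos by blast
  fix M assume "M \<in> carrier Z"
  show "K \<otimes>\<^bsub>Z\<^esub> L \<otimes>\<^bsub>Z\<^esub> M = K \<otimes>\<^bsub>Z\<^esub> (L \<otimes>\<^bsub>Z\<^esub> M)"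
    by (simp add: mult matrix_mul_assoc)
qed

lemma carrier_Z_iff:
  "K \<in> carrier Z \<longleftrightarrow> K \<in> GL2Z \<and> K ** N = N ** K \<and> (\<exists>s>0. real_mat K *v a = s *\<^sub>R a)"
  by (simp add: pos_centraliser_def)

lemma ZN_class_eq_iff:
  "ZN_class N r p = ZN_class N r p' \<longleftrightarrow> (\<exists>m n. p' = p + ((mat 1 - N) *v m + int r *s n))"
proof
  assume "ZN_class N r p = ZN_class N r p'"
  moreover have "p' = p' + ((mat 1 - N) *v 0 + int r *s 0)" by simp
  ultimately show "\<exists>m n. p' = p + ((mat 1 - N) *v m + int r *s n)" unfolding ZN_class_def by blast
next
  assume "\<exists>m n. p' = p + ((mat 1 - N) *v m + int r *s n)"
  then obtain m n where p': "p' = p + ((mat 1 - N) *v m + int r *s n)" by blast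
  have "p + ((mat 1 - N) *v m' + int r *s n') = p' + ((mat 1 - N) *v (m' - m) + int r *s (n' - n))"
    "p' + ((mat 1 - N) *v m' + int r *s n') = p + ((mat 1 - N) *v (m' + m) + int r *s (n' + n))" for m' n'
    by (simp_all add: p' matrix_vector_right_distrib matrix_vector_mult_diff_distrib
      vector_add_ldistrib vector_ssub_ldistrib)
  then show "ZN_class N r p = ZN_class N r p'" unfolding ZN_class_def by blast
qed

lemma matrix_vector_smult: "K *v (z *s m) = z *s (K *v m)" for K :: "int^2^2" and z :: int
  by (simp add: vec_eq_iff matrix_vector_mult_def sum_2 algebra_simps)

text \<open>Commuting with \<open>N\<close>, the matrix \<open>K\<close> preserves (I - N) Z^2, and
  r Z^2 is preserved by every integral matrix.\<close>

lemma ZN_act_class: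
  assumes "K \<in> carrier Z"
  shows "ZN_act N r K (ZN_class N r p) = ZN_class N r (det K *s (K *v p))"
proof -
  have cong: "ZN_class N r (det K *s (K *v p')) = ZN_class N r (det K *s (K *v p))"
    if eq: "ZN_class N r p' = ZN_class N r p" for p'
  proof -
    obtain m n where p: "p = p' + ((mat 1 - N) *v m + int r *s n)"
      using eq ZN_class_eq_iff by blast
    have "K *v (N *v m) = N *v (K *v m)"
      using assms by (simp add: carrier_Z_iff matrix_vector_mul_assoc)
    then have "K *v ((mat 1 - N) *v m) = (mat 1 - N) *v (K *v m)"
      by (simp add: matrix_vector_mult_diff_distrib matrix_vector_mult_diff_rdistrib)
    then have "det K *s (K *v p) = det K *s (K *v p') + ((mat 1 - N) *v (det K *s (K *v m)) + int r *s (det K *s (K *v n)))"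
      by (simp add: p matrix_vector_right_distrib vector_add_ldistrib matrix_vector_smult
        vector_smult_assoc mult.commute)
    then show ?thesis unfolding ZN_class_eq_iff by blast
  qed
  have "induced_map (ZN_class N r) UNIV (\<lambda>p. ZN_class N r (det K *s (K *v p))) (ZN_class N r p)
      = ZN_class N r (det K *s (K *v p))"
    by (rule induced_map_eq[OF UNIV_I]) (erule cong)
  then show ?thesis by (simp add: ZN_act_def ZN_def)
qed

lemma acting_group_ZN: "acting_group Z (ZN N r) (ZN_act N r)"
proof (intro acting_group.intro acting_group_axioms.intro group_Z)
  fix x assume "x \<in> ZN N r"
  then obtain p where x: "x = ZN_class N r p" by (auto simp: ZN_def)
  have "\<one>\<^bsub>Z\<^esub> \<in> carrier Z" by (simp add: group.is_monoid[OF group_Z] monoid.one_closed)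
  moreover have "\<one>\<^bsub>Z\<^esub> = mat 1" by (simp add: pos_centraliser_def)
  ultimately show "ZN_act N r \<one>\<^bsub>Z\<^esub> x = x" by (simp add: x ZN_act_class)
  fix g h assume g: "g \<in> carrier Z" and h: "h \<in> carrier Z"
  show "ZN_act N r g x \<in> ZN N r" by (simp add: x ZN_act_class[OF g] ZN_def)
  have "g \<otimes>\<^bsub>Z\<^esub> h \<in> carrier Z" using g h group_Z by (simp add: group.is_monoid monoid.m_closed)
  moreover have "g \<otimes>\<^bsub>Z\<^esub> h = g ** h" by (simp add: pos_centraliser_def)
  ultimately show "ZN_act N r (g \<otimes>\<^bsub>Z\<^esub> h) x = ZN_act N r g (ZN_act N r h x)"
    by (simp add: x ZN_act_class g h det_mul matrix_vector_smult vector_smult_assoc mult.commute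
      flip: matrix_vector_mul_assoc)
qed

lemma group_action_ZN: "group_action Z (ZN N r) (ZN_act N r)"
  by (rule acting_group.group_action_if_extensional[OF acting_group_ZN]) (simp add: ZN_act_def)

end

section \<open>Orbits of translation vectors and of their invariants\<close>

context compatible_pair
begin

interpretation GP: acting_group "G_grp \<alpha>" "compatible_pairs \<alpha>" P_act
  by (rule acting_group_P)

interpretation GA: acting_group "G_grp \<alpha>" "AA_set \<alpha> r" "G_act \<alpha> r"
  by (rule acting_group_G[OF adm r])

interpretation SC: acting_group Stab "C_quot \<alpha> r a b" "C_act \<alpha> r a b"
  by (rule acting_group_C)

interpretation ZA: acting_group Z "ZN N r" "ZN_act N r"
  by (rule acting_group_ZN)

abbreviation "c_orbit c \<equiv> orbit Stab (C_act \<alpha> r a b) (cls c)"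
abbreviation "p_orbit p \<equiv> orbit Z (ZN_act N r) (ZN_class N r p)"

lemma cls_in_C_quot: "c \<in> C \<Longrightarrow> cls c \<in> C_quot \<alpha> r a b"
  by (simp add: C_quot_def)

lemma c_orbit_eq_iff:
  "c \<in> C \<Longrightarrow> c' \<in> C \<Longrightarrow> c_orbit c = c_orbit c' \<longleftrightarrow> (\<exists>g\<in>carrier Stab. C_act \<alpha> r a b g (cls c) = cls c')"
  by (rule SC.orbit_eq_iff) (auto simp: cls_in_C_quot)

lemma p_orbit_eq_iff:
  "p_orbit p = p_orbit p' \<longleftrightarrow> (\<exists>K\<in>carrier Z. ZN_class N r (det K *s (K *v p)) = ZN_class N r p')"
  by (subst ZA.orbit_eq_iff) (auto simp: ZN_def ZN_act_class)

text \<open>Scaling and translation take place over the pair (\<mu> a, \<rho> b), which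
  \<open>K\<close> then brings back to (a, b); hence the scaled vectors in the formula.\<close>

lemma C_act_cls:
  assumes "\<mu> > 0" "\<rho> \<noteq> 0" "K \<in> GL2Z" "\<mu> *\<^sub>R (real_mat K *v a) = a" "\<rho> *\<^sub>R (real_mat K *v b) = b"
    and "c \<in> C"
  shows "((\<mu>, \<rho>), (K, Zd_class \<alpha> k)) \<in> carrier Stab"
    "C_act \<alpha> r a b ((\<mu>, \<rho>), (K, Zd_class \<alpha> k)) (cls c) =
      cls (K_dot_c K (\<mu> *\<^sub>R a) (\<rho> *\<^sub>R b) (k_dot_c \<alpha> k (\<mu> *\<^sub>R a) (\<rho> *\<^sub>R b) ((\<mu> * \<rho>) *\<^sub>R c)))"
proof -
  let ?g = "((\<mu>, \<rho>), (K, Zd_class \<alpha> k))"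
  have \<mu>: "\<mu> \<noteq> 0" using assms(1) by simp
  have K: "real_mat K *v (\<mu> *\<^sub>R a) = a" "real_mat K *v (\<rho> *\<^sub>R b) = b"
    using assms(4,5) by (simp_all add: matrix_vector_mult_scaleR)
  show g: "?g \<in> carrier Stab"
    using assms by (simp add: carrier_Stab_iff G_grp_carrier_iff P_act_simp)
  have "C_act \<alpha> r a b ?g (cls c) = third (G_act \<alpha> r ?g (quad_class r ((a, b, c), 0)))"
    using C_act_third[OF g quad_class_in_AA_set[OF ab assms(6), of 0]] by simp
  also have "G_act \<alpha> r ?g (quad_class r ((a, b, c), 0)) =
      quad_class r (K_rep K (k_rep \<alpha> k (scale_rep (\<mu>, \<rho>) ((a, b, c), 0))))"
    using assms(6) by (intro G_act_eq[OF adm r _ \<mu> assms(2,3)]) (simp add: A_set_def T_set_def ab)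
  also have "third \<dots> = cls (K_dot_c K (\<mu> *\<^sub>R a) (\<rho> *\<^sub>R b) (k_dot_c \<alpha> k (\<mu> *\<^sub>R a) (\<rho> *\<^sub>R b) ((\<mu> * \<rho>) *\<^sub>R c)))"
    by (simp add: scale_rep_def k_rep_def K_rep_simp K)
  finally show "C_act \<alpha> r a b ?g (cls c) = \<dots>" .
qed

lemma C_act_p_eq:
  assumes "\<mu> > 0" "\<rho> \<noteq> 0" "K \<in> GL2Z" "\<mu> *\<^sub>R (real_mat K *v a) = a" "\<rho> *\<^sub>R (real_mat K *v b) = b"
    and "p_eq \<alpha> r a b c p"
  shows "\<exists>c' n. p_eq \<alpha> r a b c' (det K *s (K *v p) + int r *s n) \<and>
    C_act \<alpha> r a b ((\<mu>, \<rho>), (K, Zd_class \<alpha> k)) (cls c) = cls c'"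
proof -
  let ?a = "\<mu> *\<^sub>R a" and ?b = "\<rho> *\<^sub>R b"
  let ?c = "k_dot_c \<alpha> k ?a ?b ((\<mu> * \<rho>) *\<^sub>R c)" and ?J = "vector [- k$2, k$1] :: int^2"
  have K: "real_mat K *v ?a = a" "real_mat K *v ?b = b"
    using assms(4,5) by (simp_all add: matrix_vector_mult_scaleR)
  have \<mu>: "\<mu> \<noteq> 0" using assms(1) by simp
  have sab: "(?a, ?b) \<in> compatible_pairs \<alpha>" by (rule compatible_pairs_scale(1)[OF ab \<mu> assms(2)])
  obtain n where "p_eq \<alpha> r a b (K_dot_c K ?a ?b ?c) (det K *s (K *v (p + int r *s ?J)) + int r *s n)"
    using p_eq_K[OF adm sab r assms(3) p_eq_k[OF adm sab r p_eq_scale[OF ab assms(6) \<mu> assms(2)]], of k]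
    unfolding K by blast
  moreover have "det K *s (K *v (p + int r *s ?J)) + int r *s n
      = det K *s (K *v p) + int r *s (det K *s (K *v ?J) + n)"
    by (simp add: matrix_vector_right_distrib matrix_vector_smult vector_add_ldistrib
      vector_smult_assoc mult.commute add.assoc)
  moreover have "c \<in> C" using assms(6) by (auto simp: C_set_def)
  ultimately show ?thesis using C_act_cls(2)[OF assms(1-5), of c k] by metis
qed

text \<open>Multiples of r are realised by pure translations, with trivial scaling and matrix; this
  accounts for r Z^2 in the residue group.\<close>

lemma c_orbit_eq_if_p_diff:
  assumes "p_eq \<alpha> r a b c p" "p_eq \<alpha> r a b c' (p + int r *s n)"
  shows "c_orbit c = c_orbit c'"
proof -
  have C: "c \<in> C" "c' \<in> C" using assms by (auto simp: C_set_def)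
  define k :: "int^2" where "k = vector [n$2, - n$1]"
  have "vector [- k$2, k$1] = n" by (simp add: k_def vec_eq_iff forall_2 vector_2)
  then have "k_dot_c \<alpha> k a b c = c'"
    using p_eq_k[OF adm ab r assms(1), of k] p_eq_cancel[OF adm ab _ assms(2)] by simp
  moreover have "K_dot_c (mat 1) a b x = x" for x
    using K_rep_one[of "((a, b, x), 0)"] by (simp add: K_rep_simp)
  ultimately have "C_act \<alpha> r a b ((1, 1), (mat 1, Zd_class \<alpha> k)) (cls c) = cls c'"
    using C_act_cls(2)[of 1 1 "mat 1" c k] one_GL2Z C by simp
  then show ?thesis
    using C_act_cls(1)[of 1 1 "mat 1" c k] one_GL2Z C by (simp add: c_orbit_eq_iff) blast
qed

lemma p_orbit_eq_if_c_orbit_eq: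
  assumes "p_eq \<alpha> r a b c p" "p_eq \<alpha> r a b c' p'" "c_orbit c = c_orbit c'"
  shows "p_orbit p = p_orbit p'"
proof -
  have c: "c \<in> C" "c' \<in> C" using assms by (auto simp: C_set_def)
  then obtain g where g: "g \<in> carrier Stab" "C_act \<alpha> r a b g (cls c) = cls c'"
    using c_orbit_eq_iff assms(3) by blast
  obtain \<mu> \<rho> K k where gd: "g = ((\<mu>, \<rho>), (K, Zd_class \<alpha> k))" "\<mu> > 0" "\<rho> \<noteq> 0" "K \<in> GL2Z"
    using g(1) unfolding carrier_Stab_iff by (blast elim: G_grp_carrierE)
  have st: "\<mu> *\<^sub>R (real_mat K *v a) = a" "\<rho> *\<^sub>R (real_mat K *v b) = b"
    using g(1) by (simp_all add: carrier_Stab_iff gd(1) P_act_simp)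
  obtain K' where K': "K ** K' = mat 1" "K' ** K = mat 1" using GL2Z_inverse[OF gd(4)] .
  \<comment> \<open>The transformed pair is (a, b) again, so its matrix is both \<open>N\<close> and
    the conjugate of \<open>N\<close> by \<open>K\<close>.\<close>
  have "N = K ** N ** K'"
    using compatible_pairs_transform(2)[OF ab K', of \<mu> \<rho>] gd(2,3) st by simp
  then have "N ** K = K ** N ** (K' ** K)" by (metis matrix_mul_assoc)
  then have "K ** N = N ** K" by (simp add: K')
  \<comment> \<open>The eigenvalue on \<open>a\<close> is the inverse of \<mu>, so \<mu> > 0 puts
    \<open>K\<close> into the positive centraliser.\<close>
  moreover have "real_mat K *v a = inverse \<mu> *\<^sub>R a"
    using gd(2) arg_cong[OF st(1), of "\<lambda>x. inverse \<mu> *\<^sub>R x"] by simp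
  ultimately have K: "K \<in> carrier Z"
    unfolding carrier_Z_iff using gd(2,4) positive_imp_inverse_positive by blast
  obtain c2 n where c2: "p_eq \<alpha> r a b c2 (det K *s (K *v p) + int r *s n)" "cls c2 = cls c'"
    using C_act_p_eq[OF gd(2-) st assms(1), of k] g(2) by (auto simp: gd(1))
  then obtain m where "p' = det K *s (K *v p) + int r *s n + (mat 1 - N) *v m"
    using c_class_eq_iff_p[OF adm ab r c2(1) assms(2)] by auto
  then have "p' = det K *s (K *v p) + ((mat 1 - N) *v m + int r *s n)"
    by (simp add: add_ac)
  then have "ZN_class N r (det K *s (K *v p)) = ZN_class N r p'"
    unfolding ZN_class_eq_iff by blast
  then show ?thesis using K p_orbit_eq_iff by blast
qed

text \<open>The way from \<open>c\<close> to \<open>c'\<close> has three steps: to \<open>c2\<close>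
  by \<open>K\<close> with the compensating scaling, to \<open>c3\<close> by a translation
  correcting the multiple of r, and finally inside one class, by the part of the difference in (I -
  N) Z^2.\<close>

lemma c_orbit_eq_if_p_orbit_eq:
  assumes "p_eq \<alpha> r a b c p" "p_eq \<alpha> r a b c' p'" "p_orbit p = p_orbit p'"
  shows "c_orbit c = c_orbit c'"
proof -
  have in_C: "x \<in> C" if "p_eq \<alpha> r a b x y" for x y using that by (auto simp: C_set_def)
  obtain K where K: "K \<in> carrier Z" "ZN_class N r (det K *s (K *v p)) = ZN_class N r p'"
    using assms(3) p_orbit_eq_iff by blast
  then obtain m n where mn: "p' = det K *s (K *v p) + ((mat 1 - N) *v m + int r *s n)"
    using ZN_class_eq_iff by blast
  obtain s where KG: "K \<in> GL2Z" and KN: "K ** N = N ** K" and s: "s > 0" "real_mat K *v a = s *\<^sub>R a"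
    using K(1) carrier_Z_iff by blast
  obtain K' where K': "K ** K' = mat 1" "K' ** K = mat 1" using GL2Z_inverse[OF KG] .
  have Kab: "(real_mat K *v a, real_mat K *v b) \<in> compatible_pairs \<alpha>"
    by (rule compatible_pairs_GL2Z(1)[OF ab KG])
  have "N_mat \<alpha> (real_mat K *v a) (real_mat K *v b) = K ** N ** K'"
    using compatible_pairs_transform(2)[OF ab K', of 1 1] by simp
  also have "\<dots> = N ** (K ** K')" unfolding KN by (simp add: matrix_mul_assoc)
  finally have "N_mat \<alpha> (real_mat K *v a) (real_mat K *v b) = N" by (simp add: K')
  then obtain \<mu> \<rho> where \<mu>\<rho>: "\<mu> \<noteq> 0" "\<rho> \<noteq> 0" "a = \<mu> *\<^sub>R (real_mat K *v a)" "b = \<rho> *\<^sub>R (real_mat K *v b)"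
    using compatible_pairs_same_N[OF adm Kab ab] by blast
  have "a \<noteq> 0" using compatible_pairsD(1)[OF ab] by (auto simp: wedge_def)
  moreover have "(\<mu> * s) *\<^sub>R a = a" using \<mu>\<rho>(3) s(2) by simp
  \<comment> \<open>Positivity of the eigenvalue \<open>s\<close> yields \<mu> > 0, as membership in
    G demands.\<close>
  ultimately have "\<mu> * s = 1" by (metis scaleR_cancel_right scaleR_one)
  then have \<mu>: "\<mu> > 0" using s(1) by (metis zero_less_mult_pos2 zero_less_one)
  obtain c2 n2 where c2: "p_eq \<alpha> r a b c2 (det K *s (K *v p) + int r *s n2)"
    "C_act \<alpha> r a b ((\<mu>, \<rho>), (K, Zd_class \<alpha> 0)) (cls c) = cls c2"
    using C_act_p_eq[OF \<mu> \<mu>\<rho>(2) KG \<mu>\<rho>(3,4)[symmetric] assms(1), of 0] by blast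
  have 1: "c_orbit c = c_orbit c2"
    using c_orbit_eq_iff[OF in_C[OF assms(1)] in_C[OF c2(1)]] c2(2)
      C_act_cls(1)[OF \<mu> \<mu>\<rho>(2) KG \<mu>\<rho>(3,4)[symmetric] in_C[OF assms(1)], of 0] by blast
  obtain c3 where c3: "p_eq \<alpha> r a b c3 (det K *s (K *v p) + int r *s n2 + int r *s (n - n2))"
    using ex_p_eq[OF adm ab] by blast
  have "p' = det K *s (K *v p) + int r *s n2 + int r *s (n - n2) + (mat 1 - N) *v m"
    by (simp add: mn vector_ssub_ldistrib)
  then have "cls c3 = cls c'"
    using c_class_eq_iff_p[OF adm ab r c3 assms(2)] by blast
  then show ?thesis
    using 1 c_orbit_eq_if_p_diff[OF c2(1) c3] by simp
qed

lemma c_orbit_eq_iff_p_orbit_eq: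
  assumes "c \<in> C" "c' \<in> C"
  shows "c_orbit c = c_orbit c' \<longleftrightarrow> p_orbit (p_of \<alpha> r a b c) = p_orbit (p_of \<alpha> r a b c')"
  using c_orbit_eq_if_p_orbit_eq p_orbit_eq_if_c_orbit_eq p_eq_p_of[OF ab r] assms by meson

lemma orbits_C_quot: "orbits Stab (C_quot \<alpha> r a b) (C_act \<alpha> r a b) = c_orbit ` C"
  by (auto simp: orbits_def C_quot_def)

text \<open>Every \<open>p\<close> is attained because I - N is invertible, so the orbits of
  residues can be indexed by \<open>c\<close>.\<close>

lemma orbits_ZN: "orbits Z (ZN N r) (ZN_act N r) = (\<lambda>c. p_orbit (p_of \<alpha> r a b c)) ` C"
proof -
  have "p \<in> p_of \<alpha> r a b ` C" for p
    using ex_p_eq[OF adm ab, of r p] p_of_eqI[OF ab r] by (auto simp: C_set_def image_iff)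
  then have surj: "p_of \<alpha> r a b ` C = UNIV" by auto
  have "orbits Z (ZN N r) (ZN_act N r) = p_orbit ` UNIV"
    by (auto simp: orbits_def ZN_def)
  then show ?thesis unfolding surj[symmetric] by (simp only: image_image)
qed

end

section \<open>Connected components\<close>

lemma continuous_map_quotient_topology: "continuous_map X (quotient_topology X q) q"
  by (auto simp: continuous_map_def openin_quotient_topology topspace_quotient_topology)

lemma topspace_T_top [simp]: "topspace (T_top \<alpha> r) = T_set \<alpha> r"
proof -
  have "T_set \<alpha> r = {(a, b, c) \<in> T_set \<alpha> r. (a, b) \<in> UNIV}" by auto
  then show ?thesis
    unfolding T_top_def topology_generated_by_topspace by blast
qed

lemma topspace_A_top [simp]: "topspace (A_top \<alpha> r) = A_set \<alpha> r"
  by (simp add: A_top_def A_set_def)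

lemma topspace_QQ_top [simp]: "topspace (QQ_top \<alpha> r) = AA_orbit \<alpha> r ` AA_set \<alpha> r"
  by (simp add: QQ_top_def AA_top_def topspace_quotient_topology AA_set_def image_image)

text \<open>Collapses the two successive quotients, so that openness can be tested on
  quadruples.\<close>

lemma openin_QQ_top:
  "openin (QQ_top \<alpha> r) U \<longleftrightarrow> U \<subseteq> AA_orbit \<alpha> r ` AA_set \<alpha> r \<and>
     openin (A_top \<alpha> r) {q \<in> A_set \<alpha> r. AA_orbit \<alpha> r (quad_class r q) \<in> U}"
proof -
  have top: "topspace (AA_top \<alpha> r) = AA_set \<alpha> r"
    by (simp add: AA_top_def topspace_quotient_topology AA_set_def)
  have "{q \<in> A_set \<alpha> r. quad_class r q \<in> {x \<in> AA_set \<alpha> r. AA_orbit \<alpha> r x \<in> U}}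
      = {q \<in> A_set \<alpha> r. AA_orbit \<alpha> r (quad_class r q) \<in> U}"
    by (auto simp: AA_set_def)
  moreover have "{x \<in> AA_set \<alpha> r. AA_orbit \<alpha> r x \<in> U} \<subseteq> quad_class r ` A_set \<alpha> r"
    by (auto simp: AA_set_def)
  ultimately show ?thesis
    unfolding QQ_top_def openin_quotient_topology top
    by (simp add: AA_top_def openin_quotient_topology)
qed

text \<open>Each member is clopen, its complement being the union of the others. The component of
  any of its points therefore stays inside it, and connectedness gives equality.\<close>

lemma connected_components_of_eqI:
  assumes "\<Union>\<S> = topspace X" "\<And>S. S \<in> \<S> \<Longrightarrow> openin X S" "\<And>S. S \<in> \<S> \<Longrightarrow> connectedin X S"
    "{} \<notin> \<S>" "\<And>S S'. S \<in> \<S> \<Longrightarrow> S' \<in> \<S> \<Longrightarrow> S \<inter> S' \<noteq> {} \<Longrightarrow> S = S'"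
  shows "connected_components_of X = \<S>"
proof -
  have comp: "connected_component_of_set X x = S" if "S \<in> \<S>" "x \<in> S" for x S
  proof
    show "S \<subseteq> connected_component_of_set X x"
      using connected_component_of_maximal[OF assms(3)[OF that(1)] that(2)] .
    have "topspace X - S = \<Union>(\<S> - {S})"
      using assms(1,5) that(1) by blast
    then have "openin X (topspace X - S)" using assms(2) by auto
    then have "closedin X S"
      using assms(2)[OF that(1)] by (simp add: closedin_def openin_subset)
    then have "connected_component_of_set X x \<subseteq> S \<or> disjnt (connected_component_of_set X x) S"
      using connectedin_clopen_cases[OF connectedin_connected_component_of _ assms(2)[OF that(1)]] by blast
    moreover have "x \<in> topspace X" using assms(1) that by blast
    ultimately show "connected_component_of_set X x \<subseteq> S"
      using that(2) by (meson connected_component_of_refl disjnt_iff mem_Collect_eq)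
  qed
  show ?thesis
  proof
    show "connected_components_of X \<subseteq> \<S>"
    proof
      fix S assume "S \<in> connected_components_of X"
      then obtain x where x: "x \<in> topspace X" "S = connected_component_of_set X x"
        by (auto simp: connected_components_of_def)
      then obtain S' where "S' \<in> \<S>" "x \<in> S'" using assms(1) by blast
      then show "S \<in> \<S>" using comp x(2) by simp
    qed
    show "\<S> \<subseteq> connected_components_of X"
    proof
      fix S assume S: "S \<in> \<S>"
      then have "S \<noteq> {}" using assms(4) by auto
      then obtain x where "x \<in> S" by blast
      then show "S \<in> connected_components_of X"
        using comp[OF S, of x] S assms(1) by (auto simp: connected_components_of_def)
    qed
  qed
qed

section \<open>Conjugacy classes of the matrices\<close>

lemma P_act_N_mat:
  assumes "(a, b) \<in> compatible_pairs \<alpha>" "\<mu> \<noteq> 0" "\<rho> \<noteq> 0" "K \<in> GL2Z"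
  shows "N_mat \<alpha> (\<mu> *\<^sub>R (real_mat K *v a)) (\<rho> *\<^sub>R (real_mat K *v b)) = K ** N_mat \<alpha> a b ** matrix_inv K"
proof -
  obtain K' where K': "K ** K' = mat 1" "K' ** K = mat 1" using GL2Z_inverse[OF assms(4)] .
  then show ?thesis
    using compatible_pairs_transform(2)[OF assms(1) K' assms(2,3)] matrix_inv_eqI[OF K'] by simp
qed

text \<open>Multiplying the conjugating matrix on the right by \<open>K\<close> or by its inverse
  translates between the two classes.\<close>

lemma conj_class_conj:
  assumes "K \<in> GL2Z"
  shows "conj_class \<alpha> (K ** M ** matrix_inv K) = conj_class \<alpha> M"
proof -
  obtain K' where K': "K' \<in> GL2Z" "K ** K' = mat 1" "K' ** K = mat 1" using GL2Z_inverse[OF assms] .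
  have inv: "matrix_inv K = K'" by (rule matrix_inv_eqI[OF K'(2,3)])
  have inv_mult: "matrix_inv (L ** L') = matrix_inv L' ** matrix_inv L"
    if L: "L \<in> GL2Z" and L': "L' \<in> GL2Z" for L L'
  proof -
    obtain M where M: "L ** M = mat 1" "M ** L = mat 1" using GL2Z_inverse[OF L] .
    obtain M' where M': "L' ** M' = mat 1" "M' ** L' = mat 1" using GL2Z_inverse[OF L'] .
    have "L ** L' ** (M' ** M) = L ** (L' ** M') ** M" "M' ** M ** (L ** L') = M' ** (M ** L) ** L'"
      by (simp_all only: matrix_mul_assoc)
    then show ?thesis
      using matrix_inv_eqI[of "L ** L'" "M' ** M"] matrix_inv_eqI[OF M] matrix_inv_eqI[OF M'] M M'
      by simp
  qed
  have 1: "L ** (K ** M ** matrix_inv K) ** matrix_inv L = (L ** K) ** M ** matrix_inv (L ** K)"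
    if "L \<in> GL2Z" for L
    by (simp add: inv_mult[OF that assms] matrix_mul_assoc)
  have 2: "L ** M ** matrix_inv L = (L ** K') ** (K ** M ** matrix_inv K) ** matrix_inv (L ** K')"
    if "L \<in> GL2Z" for L
  proof -
    have "(L ** K') ** (K ** M ** matrix_inv K) ** matrix_inv (L ** K')
        = L ** (K' ** K) ** M ** (K' ** K) ** matrix_inv L"
      unfolding inv_mult[OF that K'(1)] matrix_inv_eqI[OF K'(3,2)] inv by (simp only: matrix_mul_assoc)
    then show ?thesis by (simp add: K')
  qed
  have "(\<exists>L\<in>GL2Z. X = L ** (K ** M ** matrix_inv K) ** matrix_inv L) \<longleftrightarrow>
      (\<exists>L\<in>GL2Z. X = L ** M ** matrix_inv L)" for X
  proof safe
    fix L assume L: "L \<in> GL2Z"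
    show "\<exists>L'\<in>GL2Z. L ** (K ** M ** matrix_inv K) ** matrix_inv L = L' ** M ** matrix_inv L'"
      using 1[OF L] GL2Z_mult[OF L assms] by blast
    show "\<exists>L'\<in>GL2Z. L ** M ** matrix_inv L = L' ** (K ** M ** matrix_inv K) ** matrix_inv L'"
      using 2[OF L] GL2Z_mult[OF L K'(1)] by blast
  qed
  then show ?thesis
    by (simp only: conj_class_def)
qed

context compatible_pair
begin

interpretation GP: acting_group "G_grp \<alpha>" "compatible_pairs \<alpha>" P_act
  by (rule acting_group_P)

interpretation GA: acting_group "G_grp \<alpha>" "AA_set \<alpha> r" "G_act \<alpha> r"
  by (rule acting_group_G[OF adm r])

section \<open>The pieces of a fibre\<close>

definition component :: "real^2 \<Rightarrow> quad_class set set" where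
  "component c = {AA_orbit \<alpha> r (quad_class r ((a, b, c), t)) | t. True}"

lemma base_in_compatible_pairs: "x \<in> AA_set \<alpha> r \<Longrightarrow> base x \<in> compatible_pairs \<alpha>"
  by (elim AA_setE) simp

text \<open>With \<open>t\<close> left free, membership depends only on \<open>base\<close> and
  \<open>third\<close>, whose behaviour under G is known.\<close>

lemma in_component_iff:
  assumes "x \<in> AA_set \<alpha> r" "c \<in> C"
  shows "AA_orbit \<alpha> r x \<in> component c \<longleftrightarrow>
    (\<exists>g\<in>carrier (G_grp \<alpha>). base (G_act \<alpha> r g x) = (a, b) \<and> third (G_act \<alpha> r g x) = cls c)"
proof
  assume "AA_orbit \<alpha> r x \<in> component c"
  then obtain t where "AA_orbit \<alpha> r x = AA_orbit \<alpha> r (quad_class r ((a, b, c), t))"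
    by (auto simp: component_def)
  then obtain g where "g \<in> carrier (G_grp \<alpha>)" "G_act \<alpha> r g x = quad_class r ((a, b, c), t)"
    using GA.orbit_eq_iff[OF assms(1) quad_class_in_AA_set[OF ab assms(2)]] by blast
  then show "\<exists>g\<in>carrier (G_grp \<alpha>). base (G_act \<alpha> r g x) = (a, b) \<and> third (G_act \<alpha> r g x) = cls c"
    by (intro bexI[of _ g]) simp_all
next
  assume "\<exists>g\<in>carrier (G_grp \<alpha>). base (G_act \<alpha> r g x) = (a, b) \<and> third (G_act \<alpha> r g x) = cls c"
  then obtain g where g: "g \<in> carrier (G_grp \<alpha>)" "base (G_act \<alpha> r g x) = (a, b)" "third (G_act \<alpha> r g x) = cls c"
    by blast
  then obtain t where "G_act \<alpha> r g x = quad_class r ((a, b, c), t)"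
    using base_third_eqE[OF GA.act_closed[OF g(1) assms(1)]] by blast
  then have "AA_orbit \<alpha> r x = AA_orbit \<alpha> r (quad_class r ((a, b, c), t))"
    using GA.orbit_act[OF g(1) assms(1)] by simp
  then show "AA_orbit \<alpha> r x \<in> component c" by (auto simp: component_def)
qed

text \<open>A group element carrying a class over (a, b) to another class over (a, b) lies in the
  stabiliser.\<close>

lemma component_disjoint:
  assumes "c \<in> C" "c' \<in> C" "component c \<inter> component c' \<noteq> {}"
  shows "c_orbit c = c_orbit c'"
proof -
  obtain t where t: "AA_orbit \<alpha> r (quad_class r ((a, b, c), t)) \<in> component c'"
    using assms(3) by (auto simp: component_def)
  let ?x = "quad_class r ((a, b, c), t)"
  have x: "?x \<in> AA_set \<alpha> r" by (rule quad_class_in_AA_set[OF ab assms(1)])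
  obtain g where g: "g \<in> carrier (G_grp \<alpha>)" "base (G_act \<alpha> r g ?x) = (a, b)" "third (G_act \<alpha> r g ?x) = cls c'"
    using t in_component_iff[OF x assms(2)] by blast
  have "g \<in> carrier Stab"
    using g(1,2) base_G_act[OF adm r g(1) x] by (simp add: carrier_Stab_iff)
  moreover from this have "C_act \<alpha> r a b g (cls c) = cls c'"
    using C_act_third[OF _ x] g(3) by simp
  ultimately show ?thesis
    using c_orbit_eq_iff[OF assms(1,2)] by blast
qed

lemma component_subset:
  assumes "c \<in> C" "c' \<in> C" "c_orbit c = c_orbit c'"
  shows "component c \<subseteq> component c'"
proof
  fix X assume "X \<in> component c"
  then obtain t where X: "X = AA_orbit \<alpha> r (quad_class r ((a, b, c), t))" by (auto simp: component_def)
  let ?x = "quad_class r ((a, b, c), t)"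
  have x: "?x \<in> AA_set \<alpha> r" by (rule quad_class_in_AA_set[OF ab assms(1)])
  obtain g where g: "g \<in> carrier Stab" "C_act \<alpha> r a b g (cls c) = cls c'"
    using c_orbit_eq_iff[OF assms(1,2)] assms(3) by blast
  then have "base (G_act \<alpha> r g ?x) = (a, b)" "third (G_act \<alpha> r g ?x) = cls c'"
    using base_G_act[OF adm r _ x] C_act_third[OF g(1) x] by (auto simp: carrier_Stab_iff)
  then show "X \<in> component c'"
    unfolding X in_component_iff[OF x assms(2)] using g(1) carrier_Stab_iff by blast
qed

lemma component_eq_iff:
  assumes "c \<in> C" "c' \<in> C"
  shows "c_orbit c = c_orbit c' \<longleftrightarrow> component c = component c'"
proof
  show "c_orbit c = c_orbit c' \<Longrightarrow> component c = component c'"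
    using component_subset assms by (metis subset_antisym)
  have "component c \<noteq> {}" by (auto simp: component_def)
  then show "component c = component c' \<Longrightarrow> c_orbit c = c_orbit c'"
    using component_disjoint[OF assms] by simp
qed

lemma connectedin_component:
  assumes "c \<in> C"
  shows "connectedin (QQ_top \<alpha> r) (component c)"
proof -
  have "((a, b, c) :: triple) \<in> T_set \<alpha> r" using ab assms by (simp add: T_set_def)
  then have "continuous_map euclidean (A_top \<alpha> r) (\<lambda>t. ((a, b, c), t))"
    unfolding A_top_def by (intro continuous_map_pairedI) auto
  then have cont: "continuous_map euclidean (QQ_top \<alpha> r) (AA_orbit \<alpha> r \<circ> (quad_class r \<circ> (\<lambda>t. ((a, b, c), t))))"
    unfolding QQ_top_def AA_top_def
    by (intro continuous_map_compose[OF _ continuous_map_quotient_topology])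
  have "component c = (AA_orbit \<alpha> r \<circ> (quad_class r \<circ> (\<lambda>t. ((a, b, c), t)))) ` UNIV"
    by (auto simp: component_def)
  moreover have "connectedin euclidean (UNIV :: complex set)"
    by (simp add: connected_UNIV)
  ultimately show ?thesis
    by (simp only: connectedin_continuous_map_image[OF cont])
qed

text \<open>Near a triple, \<open>N\<close> and \<open>p\<close> are constant, hence a nearby triple differs from it by a scaling
  \<open>(\<mu>, \<rho>)\<close>; the half plane given by the inner product with the first vector forces \<open>\<mu> > 0\<close>.\<close>

lemma openin_component:
  assumes "c \<in> C"
  shows "openin (QQ_top \<alpha> r) (component c)"
  unfolding openin_QQ_top
proof
  show "component c \<subseteq> AA_orbit \<alpha> r ` AA_set \<alpha> r"
    using quad_class_in_AA_set[OF ab assms] by (auto simp: component_def)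
  show "openin (A_top \<alpha> r) {q \<in> A_set \<alpha> r. AA_orbit \<alpha> r (quad_class r q) \<in> component c}"
  proof (subst openin_subopen, safe)
    fix a' b' c' t' assume q: "((a', b', c'), t') \<in> A_set \<alpha> r"
      and comp: "AA_orbit \<alpha> r (quad_class r ((a', b', c'), t')) \<in> component c"
    have ab': "(a', b') \<in> compatible_pairs \<alpha>" and c': "c' \<in> C_set \<alpha> r a' b'"
      using q by (auto simp: A_set_def T_set_def)
    let ?x = "quad_class r ((a', b', c'), t')"
    have x: "?x \<in> AA_set \<alpha> r" by (rule quad_class_in_AA_set[OF ab' c'])
    obtain g where g: "g \<in> carrier (G_grp \<alpha>)" "base (G_act \<alpha> r g ?x) = (a, b)" "third (G_act \<alpha> r g ?x) = cls c"
      using comp in_component_iff[OF x assms] by blast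
    define W where "W = {(u, v, w) \<in> T_set \<alpha> r. N_mat \<alpha> u v \<in> {N_mat \<alpha> a' b'}}
      \<inter> {(u, v, w) \<in> T_set \<alpha> r. p_of \<alpha> r u v w \<in> {p_of \<alpha> r a' b' c'}}
      \<inter> {(u, v, w) \<in> T_set \<alpha> r. (u, v) \<in> {z. fst z \<bullet> a' > 0}}"
    have "N_mat \<alpha> a' b' \<in> SL2Z" using det_trace_N_mat(1)[OF adm ab'] by (simp add: SL2Z_def)
    moreover have "open {z :: (real^2) \<times> (real^2). fst z \<bullet> a' > 0}"
      by (intro open_Collect_less continuous_intros)
    ultimately have "openin (T_top \<alpha> r) W"
      unfolding W_def T_top_def
      by (intro openin_Int topology_generated_by_Basis) (blast+)
    then have "openin (A_top \<alpha> r) (W \<times> UNIV)"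
      unfolding A_top_def by (simp add: openin_prod_Times_iff)
    moreover have "a' \<noteq> 0" using compatible_pairsD(1)[OF ab'] by (auto simp: wedge_def)
    then have "((a', b', c'), t') \<in> W \<times> UNIV"
      using ab' c' by (simp add: W_def T_set_def)
    moreover have "q' \<in> {q \<in> A_set \<alpha> r. AA_orbit \<alpha> r (quad_class r q) \<in> component c}"
      if q': "q' \<in> W \<times> UNIV" for q'
    proof -
      obtain u v w t where qd: "q' = ((u, v, w), t)" by (metis prod.collapse)
      have uv: "(u, v) \<in> compatible_pairs \<alpha>" "w \<in> C_set \<alpha> r u v" "N_mat \<alpha> u v = N_mat \<alpha> a' b'"
        "p_of \<alpha> r u v w = p_of \<alpha> r a' b' c'" "u \<bullet> a' > 0"
        using q' by (auto simp: qd W_def T_set_def)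
      obtain \<mu> \<rho> where \<mu>\<rho>: "\<mu> \<noteq> 0" "\<rho> \<noteq> 0" "a' = \<mu> *\<^sub>R u" "b' = \<rho> *\<^sub>R v"
        using compatible_pairs_same_N[OF adm uv(1) ab' uv(3)] by blast
      have "\<mu> * (u \<bullet> u) > 0" using uv(5) by (simp add: \<mu>\<rho>(3))
      moreover have "u \<bullet> u > 0" using uv(5) by auto
      ultimately have "\<mu> > 0" by (rule zero_less_mult_pos2)
      have "p_eq \<alpha> r a' b' ((\<mu> * \<rho>) *\<^sub>R w) (p_of \<alpha> r u v w)"
        unfolding \<mu>\<rho>(3,4) by (rule p_eq_scale[OF uv(1) p_eq_p_of[OF uv(1) r uv(2)] \<mu>\<rho>(1,2)])
      then have w: "(\<mu> * \<rho>) *\<^sub>R w = c'"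
        using p_eq_cancel[OF adm ab'] p_eq_p_of[OF ab' r c'] uv(4) by metis
      let ?y = "quad_class r ((u, v, w), t)" and ?h = "((\<mu>, \<rho>), (mat 1 :: int^2^2, Zd_class \<alpha> 0))"
      have y: "?y \<in> AA_set \<alpha> r" by (rule quad_class_in_AA_set[OF uv(1,2)])
      have h: "?h \<in> carrier (G_grp \<alpha>)" using \<open>\<mu> > 0\<close> \<mu>\<rho> one_GL2Z by (simp add: G_grp_carrier_iff)
      have "G_act \<alpha> r ?h ?y = quad_class r (K_rep (mat 1) (k_rep \<alpha> 0 (scale_rep (\<mu>, \<rho>) ((u, v, w), t))))"
        using uv by (intro G_act_eq[OF adm r _ \<mu>\<rho>(1,2) one_GL2Z]) (simp add: A_set_def T_set_def)
      also have "\<dots> = quad_class r ((a', b', c'), (\<mu> * \<rho>) *\<^sub>R t)"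
        by (simp add: K_rep_one k_rep_zero scale_rep_def w \<mu>\<rho>(3,4))
      finally have hy: "base (G_act \<alpha> r ?h ?y) = base ?x" "third (G_act \<alpha> r ?h ?y) = third ?x"
        by simp_all
      have hyA: "G_act \<alpha> r ?h ?y \<in> AA_set \<alpha> r" by (rule GA.act_closed[OF h y])
      \<comment> \<open>The scaled neighbour and \<open>?x\<close> agree except possibly in
        \<open>t\<close>, so \<open>g\<close> carries both to the same pair and the same class of
        \<open>c\<close>.\<close>
      have "base (G_act \<alpha> r g (G_act \<alpha> r ?h ?y)) = (a, b)"
        using base_G_act[OF adm r g(1) hyA] base_G_act[OF adm r g(1) x] hy(1) g(2) by simp
      moreover have "third (G_act \<alpha> r g (G_act \<alpha> r ?h ?y)) = cls c"
        using third_G_act[OF adm r g(1) hyA x hy] g(3) by simp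
      ultimately have "AA_orbit \<alpha> r (G_act \<alpha> r ?h ?y) \<in> component c"
        unfolding in_component_iff[OF hyA assms] using g(1) by blast
      then have "AA_orbit \<alpha> r ?y \<in> component c"
        using GA.orbit_act[OF h y] by simp
      then show ?thesis using uv(1,2) by (simp add: qd A_set_def T_set_def)
    qed
    ultimately show "\<exists>T. openin (A_top \<alpha> r) T \<and> ((a', b', c'), t') \<in> T \<and>
        T \<subseteq> {q \<in> A_set \<alpha> r. AA_orbit \<alpha> r (quad_class r q) \<in> component c}"
      by (intro exI[of _ "W \<times> UNIV"] conjI subsetI) 
  qed
qed

section \<open>The two projections and their common fibre\<close>

lemma Phi_orbit:
  assumes "x \<in> AA_set \<alpha> r"
  shows "Phi \<alpha> r (AA_orbit \<alpha> r x) = P_orbit \<alpha> (base x)"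
proof -
  have "induced_map (AA_orbit \<alpha> r) (AA_set \<alpha> r) (\<lambda>x. P_orbit \<alpha> (base x)) (AA_orbit \<alpha> r x) = P_orbit \<alpha> (base x)"
  proof (rule induced_map_eq[OF assms])
    fix y assume y: "y \<in> AA_set \<alpha> r" "AA_orbit \<alpha> r y = AA_orbit \<alpha> r x"
    then obtain g where g: "g \<in> carrier (G_grp \<alpha>)" "G_act \<alpha> r g y = x"
      using GA.orbit_eq_iff[OF y(1) assms] by blast
    then show "P_orbit \<alpha> (base y) = P_orbit \<alpha> (base x)"
      using GP.orbit_act[OF g(1) base_in_compatible_pairs[OF y(1)]] base_G_act[OF adm r g(1) y(1)] by simp
  qed
  moreover have "(\<lambda>(a, b, C, T). P_orbit \<alpha> (a, b)) = (\<lambda>x. P_orbit \<alpha> (base x))"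
    by (auto simp: base_def)
  ultimately show ?thesis by (simp add: Phi_def)
qed

text \<open>A conjugating matrix carries one pair to the other up to two nonzero factors, since the
  eigenlines agree; a possible negative factor on the first vector is removed by a change of
  sign.\<close>

lemma P_orbit_eq_iff_conj_class_eq:
  assumes "(u, v) \<in> compatible_pairs \<alpha>"
  shows "P_orbit \<alpha> (u, v) = P_orbit \<alpha> (a, b) \<longleftrightarrow> conj_class \<alpha> (N_mat \<alpha> u v) = conj_class \<alpha> N"
proof
  assume "P_orbit \<alpha> (u, v) = P_orbit \<alpha> (a, b)"
  then obtain g where g: "g \<in> carrier (G_grp \<alpha>)" "P_act g (u, v) = (a, b)"
    using GP.orbit_eq_iff[OF assms ab] by blast
  obtain \<mu> \<rho> K k where gd: "g = ((\<mu>, \<rho>), (K, Zd_class \<alpha> k))" "\<mu> > 0" "\<rho> \<noteq> 0" "K \<in> GL2Z"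
    using g(1) by (rule G_grp_carrierE)
  then have "N = K ** N_mat \<alpha> u v ** matrix_inv K"
    using P_act_N_mat[OF assms, of \<mu> \<rho> K] g(2) by (simp add: P_act_simp)
  then show "conj_class \<alpha> (N_mat \<alpha> u v) = conj_class \<alpha> N"
    using conj_class_conj[OF gd(4)] by simp
next
  assume eq: "conj_class \<alpha> (N_mat \<alpha> u v) = conj_class \<alpha> N"
  \<comment> \<open>\<open>conj_class\<close> is cut down to \<open>N_alpha\<close>, so reflexivity
    requires \<alpha> to be an eigenvalue of \<open>N\<close> and det N = 1.\<close>
  have "N \<in> conj_class \<alpha> N"
  proof -
    have "a \<noteq> 0" using compatible_pairsD(1)[OF ab] by (auto simp: wedge_def)
    then have "N \<in> N_alpha \<alpha>"
      using det_trace_N_mat(1)[OF adm ab] compatible_pairsD(2)[OF ab] by (auto simp: N_alpha_def SL2Z_def)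
    moreover have "N = mat 1 ** N ** matrix_inv (mat 1)"
      using matrix_inv_eqI[of "mat 1" "mat 1"] by simp
    ultimately show ?thesis unfolding conj_class_def using one_GL2Z by blast
  qed
  then obtain K where K: "K \<in> GL2Z" "N = K ** N_mat \<alpha> u v ** matrix_inv K"
    using eq by (auto simp: conj_class_def)
  let ?u = "real_mat K *v u" and ?v = "real_mat K *v v"
  have "N_mat \<alpha> ?u ?v = N" using P_act_N_mat[OF assms _ _ K(1), of 1 1] K(2) by simp
  then obtain \<mu> \<rho> where \<mu>\<rho>: "\<mu> \<noteq> 0" "\<rho> \<noteq> 0" "a = \<mu> *\<^sub>R ?u" "b = \<rho> *\<^sub>R ?v"
    using compatible_pairs_same_N[OF adm compatible_pairs_GL2Z(1)[OF assms K(1)] ab] by blast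
  have "\<exists>\<mu> \<rho> K. \<mu> > 0 \<and> \<rho> \<noteq> 0 \<and> K \<in> GL2Z \<and> a = \<mu> *\<^sub>R (real_mat K *v u) \<and> b = \<rho> *\<^sub>R (real_mat K *v v)"
  proof (cases "\<mu> > 0")
    case True
    then show ?thesis using \<mu>\<rho> K(1) by blast
  next
    \<comment> \<open>Changing the signs of \<mu>, \<rho> and \<open>K\<close> together leaves both
      images unchanged and makes the first factor positive.\<close>
    case False
    have neg: "real_mat (- K) *v x = - (real_mat K *v x)" for x
      by (simp add: vec_eq_iff matrix_vector_mult_def sum_negf)
    have "- K \<in> GL2Z"
    proof -
      obtain K' where "K ** K' = mat 1" "K' ** K = mat 1" using GL2Z_inverse[OF K(1)] .
      then have "(- K) ** (- K') = mat 1" "(- K') ** (- K) = mat 1"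
        by (simp_all add: matrix_matrix_mult_def)
      then show ?thesis by (auto simp: GL2Z_def invertible_def)
    qed
    then show ?thesis
      using False \<mu>\<rho> by (intro exI[of _ "- \<mu>"] exI[of _ "- \<rho>"] exI[of _ "- K"]) (simp add: neg)
  qed
  then obtain \<mu> \<rho> K where "\<mu> > 0" "\<rho> \<noteq> 0" "K \<in> GL2Z" "a = \<mu> *\<^sub>R (real_mat K *v u)" "b = \<rho> *\<^sub>R (real_mat K *v v)"
    by blast
  then have "((\<mu>, \<rho>), (K, Zd_class \<alpha> 0)) \<in> carrier (G_grp \<alpha>)" "P_act ((\<mu>, \<rho>), (K, Zd_class \<alpha> 0)) (u, v) = (a, b)"
    by (simp_all add: G_grp_carrier_iff P_act_simp)
  then show "P_orbit \<alpha> (u, v) = P_orbit \<alpha> (a, b)"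
    using GP.orbit_eq_iff[OF assms ab] by blast
qed

lemma Psi_orbit:
  assumes "x \<in> AA_set \<alpha> r"
  shows "Psi \<alpha> r (AA_orbit \<alpha> r x) = conj_class \<alpha> (case base x of (u, v) \<Rightarrow> N_mat \<alpha> u v)"
proof -
  let ?f = "\<lambda>x. conj_class \<alpha> (case base x of (u, v) \<Rightarrow> N_mat \<alpha> u v)"
  have "induced_map (AA_orbit \<alpha> r) (AA_set \<alpha> r) ?f (AA_orbit \<alpha> r x) = ?f x"
  proof (rule induced_map_eq[OF assms])
    fix y assume y: "y \<in> AA_set \<alpha> r" "AA_orbit \<alpha> r y = AA_orbit \<alpha> r x"
    then obtain g where g: "g \<in> carrier (G_grp \<alpha>)" "G_act \<alpha> r g y = x"
      using GA.orbit_eq_iff[OF y(1) assms] by blast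
    obtain \<mu> \<rho> K k where gd: "g = ((\<mu>, \<rho>), (K, Zd_class \<alpha> k))" "\<mu> > 0" "\<rho> \<noteq> 0" "K \<in> GL2Z"
      using g(1) by (rule G_grp_carrierE)
    obtain u v where uv: "base y = (u, v)" by (cases "base y")
    then have "(u, v) \<in> compatible_pairs \<alpha>" using base_in_compatible_pairs[OF y(1)] by simp
    moreover have "base x = (\<mu> *\<^sub>R (real_mat K *v u), \<rho> *\<^sub>R (real_mat K *v v))"
      using base_G_act[OF adm r g(1) y(1)] unfolding g(2) by (simp add: uv gd(1) P_act_simp)
    ultimately show "?f y = ?f x"
      using gd P_act_N_mat[of u v \<alpha> \<mu> \<rho> K] by (simp add: uv conj_class_conj)
  qed
  moreover have "(\<lambda>(a, b, C, T). conj_class \<alpha> (N_mat \<alpha> a b)) = ?f"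
    by (auto simp: base_def)
  ultimately show ?thesis by (simp add: Psi_def)
qed

lemma QQ_set_eq: "QQ_set \<alpha> r = AA_orbit \<alpha> r ` AA_set \<alpha> r"
  by (auto simp: QQ_set_def orbits_def)

lemma Phi_fibre_eq_Psi_fibre: "Phi_fibre \<alpha> r a b = Psi_fibre \<alpha> r N"
proof -
  have "Phi \<alpha> r (AA_orbit \<alpha> r x) = P_orbit \<alpha> (a, b) \<longleftrightarrow> Psi \<alpha> r (AA_orbit \<alpha> r x) = conj_class \<alpha> N"
    if "x \<in> AA_set \<alpha> r" for x
    using P_orbit_eq_iff_conj_class_eq[of "fst (base x)" "snd (base x)"] base_in_compatible_pairs[OF that]
    by (simp add: Phi_orbit[OF that] Psi_orbit[OF that] split: prod.splits)
  then show ?thesis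
    unfolding Phi_fibre_def Psi_fibre_def QQ_set_eq by blast
qed

text \<open>A class whose pair lies in the orbit of (a, b) can be moved over (a, b) itself without
  changing its G-orbit.\<close>

lemma Phi_fibre_eq_Union: "Phi_fibre \<alpha> r a b = \<Union>(component ` C)"
proof
  show "Phi_fibre \<alpha> r a b \<subseteq> \<Union>(component ` C)"
  proof
    fix X assume "X \<in> Phi_fibre \<alpha> r a b"
    then obtain x where x: "x \<in> AA_set \<alpha> r" "X = AA_orbit \<alpha> r x" "P_orbit \<alpha> (base x) = P_orbit \<alpha> (a, b)"
      by (auto simp: Phi_fibre_def QQ_set_eq Phi_orbit)
    then obtain g where g: "g \<in> carrier (G_grp \<alpha>)" "P_act g (base x) = (a, b)"
      using GP.orbit_eq_iff[OF base_in_compatible_pairs[OF x(1)] ab] by blast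
    have y: "G_act \<alpha> r g x \<in> AA_set \<alpha> r" "base (G_act \<alpha> r g x) = (a, b)"
      using GA.act_closed[OF g(1) x(1)] base_G_act[OF adm r g(1) x(1)] g(2) by simp_all
    then obtain c t where "G_act \<alpha> r g x = quad_class r ((a, b, c), t)" "c \<in> C"
      by (auto elim: AA_setE)
    then have "X \<in> component c"
      using GA.orbit_act[OF g(1) x(1)] x(2) by (auto simp: component_def)
    then show "X \<in> \<Union>(component ` C)" using \<open>c \<in> C\<close> by blast
  qed
  show "\<Union>(component ` C) \<subseteq> Phi_fibre \<alpha> r a b"
    using quad_class_in_AA_set[OF ab] by (auto simp: component_def Phi_fibre_def QQ_set_eq Phi_orbit)
qed

lemma connected_components_Phi_fibre:
  "connected_components_of (subtopology (QQ_top \<alpha> r) (Phi_fibre \<alpha> r a b)) = component ` C"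
proof (rule connected_components_of_eqI)
  have sub: "component c \<subseteq> Phi_fibre \<alpha> r a b" if "c \<in> C" for c
    using that Phi_fibre_eq_Union by blast
  have "Phi_fibre \<alpha> r a b \<subseteq> topspace (QQ_top \<alpha> r)"
    by (auto simp: Phi_fibre_def QQ_set_eq)
  then show "\<Union>(component ` C) = topspace (subtopology (QQ_top \<alpha> r) (Phi_fibre \<alpha> r a b))"
    by (simp only: topspace_subtopology Phi_fibre_eq_Union) blast
  show "openin (subtopology (QQ_top \<alpha> r) (Phi_fibre \<alpha> r a b)) S"
    "connectedin (subtopology (QQ_top \<alpha> r) (Phi_fibre \<alpha> r a b)) S" if "S \<in> component ` C" for S
    using that sub openin_component connectedin_component
    by (auto simp: connectedin_subtopology intro!: subset_openin_subtopology)
  show "{} \<notin> component ` C" by (auto simp: component_def)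
  show "S = S'" if "S \<in> component ` C" "S' \<in> component ` C" "S \<inter> S' \<noteq> {}" for S S'
    using that component_disjoint component_eq_iff by blast
qed

end

theorem theorem4p35:
  fixes \<alpha> :: real and a b :: "real^2" and r :: nat and N :: "int^2^2"
  assumes "S_plus_admissible \<alpha>"
    and "(a, b) \<in> compatible_pairs \<alpha>"
    and "r \<ge> 1"
    and "N = N_mat \<alpha> a b"
  shows
    "Phi_fibre \<alpha> r a b = Psi_fibre \<alpha> r N \<and>
     (\<exists>F. bij_betw F
            (orbits (stab_grp \<alpha> a b) (C_quot \<alpha> r a b) (C_act \<alpha> r a b))
            (connected_components_of (subtopology (QQ_top \<alpha> r) (Phi_fibre \<alpha> r a b))) \<and>
          (\<forall>c \<in> C_set \<alpha> r a b.
             F (orbit (stab_grp \<alpha> a b) (C_act \<alpha> r a b) (c_class r a b c)) =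
             {AA_orbit \<alpha> r (quad_class r ((a, b, c), t)) | t. True})) \<and>
     group_action (pos_centraliser N a) (ZN N r) (ZN_act N r) \<and>
     (\<forall>K \<in> carrier (pos_centraliser N a). \<forall>p.
        ZN_act N r K (ZN_class N r p) = ZN_class N r (det K *s (K *v p))) \<and>
     (\<exists>I. bij_betw I
            (orbits (stab_grp \<alpha> a b) (C_quot \<alpha> r a b) (C_act \<alpha> r a b))
            (orbits (pos_centraliser N a) (ZN N r) (ZN_act N r)) \<and>
          (\<forall>c \<in> C_set \<alpha> r a b.
             I (orbit (stab_grp \<alpha> a b) (C_act \<alpha> r a b) (c_class r a b c)) =
             orbit (pos_centraliser N a) (ZN_act N r) (ZN_class N r (p_of \<alpha> r a b c))))"
proof -
  interpret compatible_pair \<alpha> a b r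
    by unfold_locales (use assms in auto)
  \<comment> \<open>All three index sets are rewritten as images of \<open>C\<close>, so that the
    parametrisation by \<open>c\<close> yields both bijections at once.\<close>
  show ?thesis
    unfolding assms(4) orbits_C_quot orbits_ZN connected_components_Phi_fibre component_def[symmetric]
    using Phi_fibre_eq_Psi_fibre group_action_ZN ZN_act_class
      bij_betw_quotients[of C c_orbit component, OF component_eq_iff]
      bij_betw_quotients[of C c_orbit "\<lambda>c. p_orbit (p_of \<alpha> r a b c)", OF c_orbit_eq_iff_p_orbit_eq]
    by blast
qed

end
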